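(* Let $s\ge 0$ and $k\ge 1$ be integers and let $t_1,\ldots,t_k\ge 5$ be odd integers. Then there exists $n_0$ (depending on $s,k,t_1,\ldots,t_k$) such that for every $n\ge n_0$ the following holds: if $G$ is an $n$-vertex graph which does not contain $H_{s,t_1,\ldots,t_k}$ as a subgraph and $G$ has the maximum spectral radius among all $n$-vertex graphs not containing $H_{s,t_1,\ldots,t_k}$ as a subgraph, then $$G\in \mathrm{Ex}(n,H_{s,t_1,\ldots,t_k}).$$
   Context: All graphs are simple, finite and undirected. $H_{s,t_1,\ldots,t_k}$ is the graph consisting of $s$ triangles and $k$ odd cycles of lengths $t_1,\ldots,t_k$ which all intersect in exactly one common vertex (any two of these cycles share that vertex and nothing else). A graph is $F$-free if it has no (not necessarily induced) subgraph isomorphic to $F$. $\mathrm{ex}(n,F)$ is the maximum number of edges of an $F$-free graph on $n$ vertices, and $\mathrm{Ex}(n,F)$ is the set of all $F$-free graphs on $n$ vertices with exactly $\mathrm{ex}(n,F)$ edges. The spectral radius $\lambda(G)$ of a graph $G$ is the largest absolute value of an eigenvalue of its adjacency matrix (equivalently, its largest eigenvalue). *)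

theory Defs
  imports "Jordan_Normal_Form.Spectral_Radius"
begin

type_synonym 'a graph = "'a set \<times> 'a set set"

abbreviation vertices :: "'a graph \<Rightarrow> 'a set" where "vertices \<equiv> fst"
abbreviation edges :: "'a graph \<Rightarrow> 'a set set" where "edges \<equiv> snd"

definition simple_graph :: "'a graph \<Rightarrow> bool" where
  "simple_graph G \<longleftrightarrow> finite (vertices G) \<and> (\<forall>e\<in>edges G. e \<subseteq> vertices G \<and> card e = 2)"

definition subgraph :: "'a graph \<Rightarrow> 'a graph \<Rightarrow> bool" where
  "subgraph H G \<longleftrightarrow> simple_graph H \<and> simple_graph G
     \<and> vertices H \<subseteq> vertices G \<and> edges H \<subseteq> edges G"

definition graph_isomorphic :: "'a graph \<Rightarrow> 'b graph \<Rightarrow> bool" where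
  "graph_isomorphic G H \<longleftrightarrow>
     (\<exists>f. bij_betw f (vertices G) (vertices H) \<and> edges H = (\<lambda>e. f ` e) ` edges G)"

definition graph_free :: "'b graph \<Rightarrow> 'a graph \<Rightarrow> bool" where
  "graph_free F G \<longleftrightarrow> (\<nexists>H. subgraph H G \<and> graph_isomorphic F H)"

text \<open>The cycles of lengths \<open>ls ! 0, ls ! 1, \<dots>\<close> (each at least 3) glued at one common vertex
  \<open>(0, 0)\<close>; the remaining vertices of the \<open>i\<close>-th cycle are \<open>(i, 1), \<dots>, (i, ls ! i - 1)\<close>.\<close>

definition bouquet_vertex :: "nat \<Rightarrow> nat \<Rightarrow> nat \<times> nat" where
  "bouquet_vertex i j = (if j = 0 then (0, 0) else (i, j))"

definition cycle_bouquet :: "nat list \<Rightarrow> (nat \<times> nat) graph" where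
  "cycle_bouquet ls =
    (insert (0, 0) (\<Union>i<length ls. bouquet_vertex i ` {..<ls ! i}),
     \<Union>i<length ls. (\<lambda>j. {bouquet_vertex i j, bouquet_vertex i (Suc j mod ls ! i)}) ` {..<ls ! i})"

definition intersecting_odd_cycles :: "nat \<Rightarrow> nat list \<Rightarrow> (nat \<times> nat) graph" where
  "intersecting_odd_cycles s ts = cycle_bouquet (replicate s 3 @ ts)"

text \<open>Graphs on \<open>n\<close> vertices are taken, up to isomorphism, on the vertex set \<open>{..<n}\<close>.\<close>

definition free_graphs :: "nat \<Rightarrow> 'b graph \<Rightarrow> nat graph set" where
  "free_graphs n F = {G. simple_graph G \<and> vertices G = {..<n} \<and> graph_free F G}"

definition ex_number :: "nat \<Rightarrow> 'b graph \<Rightarrow> nat" where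
  "ex_number n F = Max ((\<lambda>G. card (edges G)) ` free_graphs n F)"

definition Ex_graphs :: "nat \<Rightarrow> 'b graph \<Rightarrow> nat graph set" where
  "Ex_graphs n F = {G \<in> free_graphs n F. card (edges G) = ex_number n F}"

text \<open>The matrix is complex because the library's \<^const>\<open>spectral_radius\<close>, the maximal modulus of
  an eigenvalue, is defined for complex matrices.\<close>

definition adjacency_matrix :: "nat \<Rightarrow> nat graph \<Rightarrow> complex mat" where
  "adjacency_matrix n G = mat n n (\<lambda>(i, j). if {i, j} \<in> edges G then 1 else 0)"

definition spectral_extremal_graphs :: "nat \<Rightarrow> 'b graph \<Rightarrow> nat graph set" where
  "spectral_extremal_graphs n F =
    {G \<in> free_graphs n F. \<forall>G'\<in>free_graphs n F.
       spectral_radius (adjacency_matrix n G') \<le> spectral_radius (adjacency_matrix n G)}"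

end

theory Submission
  imports Defs "HOL-Analysis.Convex"
begin

text \<open>
  Let \<open>F\<close> be the bouquet, \<open>\<lambda>\<close> the spectral radius of an extremal graph \<open>G\<close> and \<open>x\<close> a nonnegative
  eigenvector with maximal entry \<open>x v = 1\<close>. Deleting the centre of \<open>F\<close> leaves disjoint paths, so a
  neighbourhood in an \<open>F\<close>-free graph contains no long path and spans only \<open>O(n)\<close> edges. As \<open>\<lambda>\<^sup>2\<close> is at
  most the number of walks of length two from \<open>v\<close>, and \<open>\<lambda>\<^sup>2 \<ge> \<lfloor>n\<^sup>2/4\<rfloor>\<close>, only \<open>O(n)\<close> pairs between \<open>N(v)\<close>
  and its complement are non-adjacent; neither regularity nor stability theorems are needed.

  The main tool is replacing the neighbourhood of a vertex \<open>u\<close> by a set \<open>W\<close> any few elements of which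
  have many common neighbours. This keeps the graph \<open>F\<close>-free, because \<open>u\<close> can be exchanged for
  another vertex in a copy of \<open>F\<close>, so maximality of \<open>\<lambda>\<close> yields \<open>\<Sum>\<^sub>W x \<le> \<lambda> x u\<close>. It follows in turn that
  all entries of \<open>x\<close> are \<open>1 - O(1/n)\<close>, that \<open>G\<close> has a bipartition \<open>S, T\<close> with bounded inner degrees and
  bounded numbers of missing cross edges at each vertex, and that vertices of \<open>S\<close> without inner
  neighbours are joined to all of \<open>T\<close>. A large matching inside a part would produce \<open>F\<close>, so only \<open>p = O(1)\<close>
  edges are inner and \<open>q = O(1)\<close> cross edges are missing.

  Summing the eigenvalue equation over the two parts gives \<open>\<lambda>\<^sup>2 \<le> |S| |T| + 2 (p - q) + O(1/n)\<close>. Every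
  graph satisfies \<open>\<lambda>\<^sup>2 \<ge> 2 e - \<lfloor>n\<^sup>2/4\<rfloor>\<close>. Applied to the graph obtained from \<open>G\<close> by balancing its parts,
  which has \<open>\<lfloor>n\<^sup>2/4\<rfloor> + p - q\<close> edges, this forces \<open>|S| |T| = \<lfloor>n\<^sup>2/4\<rfloor>\<close>, and applied to any \<open>F\<close>-free graph
  it then bounds the number of edges by that of \<open>G\<close>.
\<close>

section \<open>Spectral radius of symmetric nonnegative matrices\<close>

lemma spectral_radius_nonneg:
  assumes "A \<in> carrier_mat n n" "0 < n"
  shows "0 \<le> spectral_radius A"
  using spectral_radius_mem_max(1)[OF assms] by auto

text \<open>The estimates concern real numbers, so a matrix acts on real functions here;
  \<open>complex_mat\<close> carries it to where \<open>spectral_radius\<close> is defined.\<close>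

definition real_apply :: "nat \<Rightarrow> (nat \<Rightarrow> nat \<Rightarrow> real) \<Rightarrow> (nat \<Rightarrow> real) \<Rightarrow> nat \<Rightarrow> real" where
  "real_apply n a u i = (\<Sum>j<n. a i j * u j)"

definition complex_mat :: "nat \<Rightarrow> (nat \<Rightarrow> nat \<Rightarrow> real) \<Rightarrow> complex mat" where
  "complex_mat n a = mat n n (\<lambda>(i, j). complex_of_real (a i j))"

lemma complex_mat_carrier [simp]: "complex_mat n a \<in> carrier_mat n n"
  by (simp add: complex_mat_def)

lemma real_apply_pow:
  "complex_mat n a ^\<^sub>m k *\<^sub>v vec n (\<lambda>i. complex_of_real (u i)) =
   vec n (\<lambda>i. complex_of_real ((real_apply n a ^^ k) u i))"
proof (induction k arbitrary: u)
  case 0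
  show ?case by (simp add: complex_mat_def)
next
  case (Suc k)
  have "complex_mat n a *\<^sub>v vec n (\<lambda>i. complex_of_real (u i)) =
        vec n (\<lambda>i. complex_of_real (real_apply n a u i))"
    by (rule eq_vecI)
      (auto simp: complex_mat_def real_apply_def scalar_prod_def atLeast0LessThan intro!: sum.cong)
  moreover have "complex_mat n a ^\<^sub>m Suc k *\<^sub>v vec n (\<lambda>i. complex_of_real (u i)) =
        complex_mat n a ^\<^sub>m k *\<^sub>v (complex_mat n a *\<^sub>v vec n (\<lambda>i. complex_of_real (u i)))"
    by (simp, rule assoc_mult_mat_vec[where ?n\<^sub>1.0=n and ?n\<^sub>2.0=n and ?n\<^sub>3.0=n])
      (auto intro: pow_carrier_mat)
  ultimately show ?case using Suc by (simp add: funpow_swap1)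
qed

lemma real_apply_symmetric:
  assumes "\<And>i j. i < n \<Longrightarrow> j < n \<Longrightarrow> a i j = a j i"
  shows "(\<Sum>i<n. real_apply n a u i * w i) = (\<Sum>i<n. u i * real_apply n a w i)"
proof -
  have "(\<Sum>i<n. real_apply n a u i * w i) = (\<Sum>i<n. \<Sum>j<n. a i j * u j * w i)"
    by (simp add: real_apply_def sum_distrib_right)
  also have "\<dots> = (\<Sum>j<n. \<Sum>i<n. a i j * u j * w i)" by (rule sum.swap)
  also have "\<dots> = (\<Sum>j<n. u j * real_apply n a w j)"
    unfolding real_apply_def sum_distrib_left
    by (intro sum.cong refl) (use assms in \<open>auto simp: mult_ac\<close>)
  finally show ?thesis .
qed

text \<open>Otherwise the squared norms of the iterates, which are log-convex by Cauchy-Schwarz, would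
  grow geometrically, whereas the powers of the matrix are bounded.\<close>

lemma symmetric_contraction:
  assumes sym: "\<And>i j. i < n \<Longrightarrow> j < n \<Longrightarrow> a i j = a j i"
    and sr: "spectral_radius (complex_mat n a) < 1"
  shows "(\<Sum>i<n. (real_apply n a u i)\<^sup>2) \<le> (\<Sum>i<n. (u i)\<^sup>2)"
proof (rule ccontr)
  define it where "it k = (real_apply n a ^^ k) u" for k
  define s where "s k = (\<Sum>i<n. (it k i)\<^sup>2)" for k
  have it_Suc: "it (Suc k) = real_apply n a (it k)" for k by (simp add: it_def)
  assume "\<not> ?thesis"
  hence gt: "s 1 > s 0" by (simp add: s_def it_def)
  have s_nonneg: "s k \<ge> 0" for k by (simp add: s_def sum_nonneg)
  have conv: "(s (Suc k))\<^sup>2 \<le> s k * s (Suc (Suc k))" for k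
  proof -
    have "s (Suc k) = (\<Sum>i<n. real_apply n a (it k) i * it (Suc k) i)"
      by (simp add: s_def it_Suc power2_eq_square)
    also have "\<dots> = (\<Sum>i<n. it k i * it (Suc (Suc k)) i)"
      by (subst real_apply_symmetric[OF sym]) (simp_all add: it_Suc)
    finally show ?thesis using Cauchy_Schwarz_ineq_sum[of "it k" "it (Suc (Suc k))" "{..<n}"]
      by (simp add: s_def)
  qed
  have s0: "s 0 > 0"
    using conv[of 0] gt s_nonneg[of 0] by (cases "s 0 = 0") auto
  define g where "g = s 1 / s 0"
  have g: "g > 1" using gt s0 by (simp add: g_def)
  \<comment> \<open>Log-convexity makes the quotients \<open>s (Suc k) / s k\<close> nondecreasing,
    so the first one, \<open>g\<close>, bounds them all from below.\<close>
  have ratio: "s k > 0 \<and> s (Suc k) \<ge> g * s k" for k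
  proof (induction k)
    case 0
    show ?case using s0 by (simp add: g_def)
  next
    case (Suc k)
    have pos: "s (Suc k) > 0" using Suc g by (smt (verit) mult_pos_pos)
    have "g * s (Suc k) * s (Suc k) \<le> g * (s k * s (Suc (Suc k)))"
      using conv[of k] g by (simp add: power2_eq_square)
    also have "\<dots> = g * s k * s (Suc (Suc k))" by simp
    also have "\<dots> \<le> s (Suc k) * s (Suc (Suc k))"
      using Suc s_nonneg by (intro mult_right_mono) auto
    finally have "s (Suc k) * (g * s (Suc k)) \<le> s (Suc k) * s (Suc (Suc k))"
      by (simp add: mult_ac)
    hence "g * s (Suc k) \<le> s (Suc (Suc k))" using pos by simp
    thus ?case using pos by simp
  qed
  have growth: "s k \<ge> g ^ k * s 0" for k
  proof (induction k)
    case (Suc k)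
    have "g ^ Suc k * s 0 \<le> g * s k" using Suc g by simp
    also have "\<dots> \<le> s (Suc k)" using ratio by auto
    finally show ?case .
  qed simp
  obtain c where c: "\<And>k. norm_bound (complex_mat n a ^\<^sub>m k) c"
    using spectral_radius_jnf_norm_bound_less_1_upper_triangular[OF complex_mat_carrier sr] by auto
  define M where "M = \<bar>c\<bar> * (\<Sum>j<n. \<bar>u j\<bar>)"
  have bound: "\<bar>it k i\<bar> \<le> M" if "i < n" for k i
  proof -
    let ?U = "vec n (\<lambda>i. complex_of_real (u i))"
    have car: "complex_mat n a ^\<^sub>m k \<in> carrier_mat n n" by (rule pow_carrier_mat) simp
    have "complex_of_real (it k i) = (complex_mat n a ^\<^sub>m k *\<^sub>v ?U) $ i"
      using that by (simp add: real_apply_pow it_def)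
    also have "\<dots> = (\<Sum>j<n. (complex_mat n a ^\<^sub>m k) $$ (i, j) * complex_of_real (u j))"
      using that carrier_matD[OF car] by (simp add: scalar_prod_def atLeast0LessThan)
    finally have "\<bar>it k i\<bar> = norm \<dots>" by (metis norm_of_real)
    also have "\<dots> \<le> (\<Sum>j<n. \<bar>c\<bar> * \<bar>u j\<bar>)"
    proof (rule sum_norm_le)
      fix j assume "j \<in> {..<n}"
      hence "norm ((complex_mat n a ^\<^sub>m k) $$ (i, j)) \<le> \<bar>c\<bar>"
        using c[of k] that carrier_matD[OF car] unfolding norm_bound_def by (simp add: abs_if) (smt (verit))
      thus "norm ((complex_mat n a ^\<^sub>m k) $$ (i, j) * complex_of_real (u j)) \<le> \<bar>c\<bar> * \<bar>u j\<bar>"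
        by (simp add: norm_mult mult_right_mono)
    qed
    finally show ?thesis by (simp add: M_def sum_distrib_left)
  qed
  have "s k \<le> real n * M\<^sup>2" for k
  proof -
    have "s k \<le> (\<Sum>i<n. M\<^sup>2)" unfolding s_def
      using bound by (intro sum_mono) (metis abs_ge_zero lessThan_iff power2_abs power_mono)
    thus ?thesis by simp
  qed
  moreover obtain k where "real n * M\<^sup>2 / s 0 < g ^ k" using real_arch_pow[OF g] by auto
  ultimately show False using growth[of k] s0
    by (simp add: pos_divide_less_eq) (meson leD le_less_trans order_trans)
qed

text \<open>An eigenvalue \<mu> of the scaled matrix yields the eigenvalue \<open>c * \<mu>\<close>
  of the original one.\<close>

lemma spectral_radius_scale_less:
  assumes "0 < n" "spectral_radius (complex_mat n a) < c"
  shows "spectral_radius (complex_mat n (\<lambda>i j. a i j / c)) < 1"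
proof -
  let ?A = "complex_mat n a" and ?B = "complex_mat n (\<lambda>i j. a i j / c)"
  have c: "c > 0" using assms spectral_radius_nonneg[OF complex_mat_carrier] by (meson le_less_trans)
  obtain \<mu> where \<mu>: "eigenvalue ?B \<mu>" "spectral_radius ?B = norm \<mu>"
    using spectral_radius_mem_max(1)[OF complex_mat_carrier assms(1)] by (auto simp: spectrum_def)
  obtain v where v: "v \<in> carrier_vec n" "v \<noteq> 0\<^sub>v n" "?B *\<^sub>v v = \<mu> \<cdot>\<^sub>v v"
    using \<mu>(1) unfolding eigenvalue_def eigenvector_def by (auto simp: complex_mat_def)
  have "?A *\<^sub>v v = complex_of_real c \<cdot>\<^sub>v (?B *\<^sub>v v)"
    using v(1) c by (intro eq_vecI)
      (auto simp: complex_mat_def scalar_prod_def sum_distrib_left intro!: sum.cong)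
  hence "?A *\<^sub>v v = (complex_of_real c * \<mu>) \<cdot>\<^sub>v v" by (simp add: v(3) smult_smult_assoc)
  hence "eigenvalue ?A (complex_of_real c * \<mu>)"
    using v unfolding eigenvalue_def eigenvector_def by (auto simp: complex_mat_def)
  hence "norm (complex_of_real c * \<mu>) \<le> spectral_radius ?A"
    using spectral_radius_mem_max(2)[OF complex_mat_carrier assms(1)] by (auto simp: spectrum_def)
  hence "c * norm \<mu> \<le> spectral_radius ?A" using c by (simp add: norm_mult)
  hence "c * norm \<mu> < c * 1" using assms(2) by linarith
  hence "norm \<mu> < 1" using c by (rule mult_left_less_imp_less[OF _ less_imp_le])
  thus ?thesis using \<mu>(2) by simp
qed

text \<open>\<open>symmetric_contraction\<close> needs a spectral radius strictly below 1, so the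
  matrix is divided by \<open>?\<rho> + e\<close> and \<open>e\<close> tends to 0 from the
  right.\<close>

lemma symmetric_norm_le_spectral_radius:
  assumes sym: "\<And>i j. i < n \<Longrightarrow> j < n \<Longrightarrow> a i j = a j i" and "0 < n"
  shows "(\<Sum>i<n. (real_apply n a u i)\<^sup>2) \<le> (spectral_radius (complex_mat n a))\<^sup>2 * (\<Sum>i<n. (u i)\<^sup>2)"
    (is "?L \<le> ?\<rho>\<^sup>2 * ?R")
proof -
  have \<rho>: "?\<rho> \<ge> 0" using assms(2) by (intro spectral_radius_nonneg) auto
  have "?L \<le> (?\<rho> + e)\<^sup>2 * ?R" if e: "e > 0" for e
  proof -
    let ?c = "?\<rho> + e"
    have "(\<Sum>i<n. (real_apply n (\<lambda>i j. a i j / ?c) u i)\<^sup>2) \<le> ?R"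
      using sym e assms(2) by (intro symmetric_contraction spectral_radius_scale_less) auto
    moreover have "real_apply n (\<lambda>i j. a i j / ?c) u i = real_apply n a u i / ?c" for i
      by (simp add: real_apply_def sum_divide_distrib)
    ultimately have "?L / ?c\<^sup>2 \<le> ?R" by (simp add: power_divide sum_divide_distrib)
    thus ?thesis using e \<rho> by (simp add: divide_le_eq mult.commute)
  qed
  hence "\<forall>\<^sub>F e in at_right 0. ?L \<le> (?\<rho> + e)\<^sup>2 * ?R"
    by (auto simp: eventually_at_right_field intro: exI[of _ 1])
  moreover have "((\<lambda>e. (?\<rho> + e)\<^sup>2 * ?R) \<longlongrightarrow> (?\<rho> + 0)\<^sup>2 * ?R) (at_right 0)"
    by (intro tendsto_intros)
  ultimately show ?thesis
    using tendsto_lowerbound[of _ "(?\<rho> + 0)\<^sup>2 * ?R" "at_right (0::real)" ?L] by simp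
qed

text \<open>The moduli of the entries of a dominant eigenvector \<open>z\<close> satisfy \<open>A |z| \<ge> \<rho> |z|\<close> entrywise, and
  the norm bound turns this into an equality.\<close>

lemma nonneg_symmetric_eigenvector:
  assumes sym: "\<And>i j. i < n \<Longrightarrow> j < n \<Longrightarrow> a i j = a j i" and "0 < n"
    and nonneg: "\<And>i j. 0 \<le> a i j"
  obtains x v where "\<And>i. i < n \<Longrightarrow> 0 \<le> x i \<and> x i \<le> 1" "v < n" "x v = (1::real)"
    "\<And>i. i < n \<Longrightarrow> real_apply n a x i = spectral_radius (complex_mat n a) * x i"
proof -
  let ?A = "complex_mat n a" let ?\<rho> = "spectral_radius ?A"
  have \<rho>: "?\<rho> \<ge> 0" using assms(2) by (intro spectral_radius_nonneg) auto
  obtain \<mu> where \<mu>: "eigenvalue ?A \<mu>" "?\<rho> = norm \<mu>"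
    using spectral_radius_mem_max(1)[OF complex_mat_carrier assms(2)] by (auto simp: spectrum_def)
  obtain z where z: "z \<in> carrier_vec n" "z \<noteq> 0\<^sub>v n" "?A *\<^sub>v z = \<mu> \<cdot>\<^sub>v z"
    using \<mu>(1) unfolding eigenvalue_def eigenvector_def by (auto simp: complex_mat_def)
  define y where "y i = norm (z $ i)" for i
  have sub: "?\<rho> * y i \<le> real_apply n a y i" if "i < n" for i
  proof -
    have "\<mu> * z $ i = (?A *\<^sub>v z) $ i" using that z by simp
    also have "\<dots> = (\<Sum>j<n. complex_of_real (a i j) * z $ j)"
      using that z(1) by (auto simp: complex_mat_def scalar_prod_def atLeast0LessThan intro!: sum.cong)
    finally have "norm (\<mu> * z $ i) \<le> (\<Sum>j<n. norm (complex_of_real (a i j) * z $ j))"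
      by (simp add: norm_sum)
    thus ?thesis using nonneg \<mu>(2) by (simp add: norm_mult y_def real_apply_def)
  qed
  have eq: "real_apply n a y i = ?\<rho> * y i" if "i < n" for i
  proof (rule ccontr)
    assume neq: "real_apply n a y i \<noteq> ?\<rho> * y i"
    have le: "(?\<rho> * y j)\<^sup>2 \<le> (real_apply n a y j)\<^sup>2" if "j < n" for j
      using sub[OF that] \<rho> by (intro power_mono) (auto simp: y_def)
    have "(\<Sum>j<n. (?\<rho> * y j)\<^sup>2) < (\<Sum>j<n. (real_apply n a y j)\<^sup>2)"
    proof (rule sum_strict_mono_ex1)
      show "\<exists>j\<in>{..<n}. (?\<rho> * y j)\<^sup>2 < (real_apply n a y j)\<^sup>2"
        using neq sub[OF that] \<rho> that
        by (intro bexI[of _ i] power_strict_mono) (auto simp: y_def)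
    qed (use le in auto)
    moreover have "(\<Sum>j<n. (?\<rho> * y j)\<^sup>2) = ?\<rho>\<^sup>2 * (\<Sum>j<n. (y j)\<^sup>2)"
      by (simp add: power_mult_distrib sum_distrib_left)
    ultimately show False using symmetric_norm_le_spectral_radius[where a = a and u = y, OF sym assms(2)] by simp
  qed
  define m where "m = Max (y ` {..<n})"
  have ne: "y ` {..<n} \<noteq> {}" using assms(2) by auto
  have "m \<in> y ` {..<n}" unfolding m_def using ne by (intro Max_in) auto
  then obtain v where v: "v < n" "y v = m" by auto
  have le_m: "y i \<le> m" if "i < n" for i unfolding m_def using that by (intro Max_ge) auto
  obtain i0 where "i0 < n" "z $ i0 \<noteq> 0"
    using z(1,2) by (metis carrier_vecD eq_vecI index_zero_vec(1,2))
  hence m: "m > 0" using le_m[of i0] by (simp add: y_def) (metis less_le_trans zero_less_norm_iff)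
  show thesis
  proof (rule that[of "\<lambda>i. y i / m" v])
    show "0 \<le> y i / m \<and> y i / m \<le> 1" if "i < n" for i
      using le_m[OF that] m by (auto simp: y_def)
    show "real_apply n a (\<lambda>i. y i / m) i = ?\<rho> * (y i / m)" if "i < n" for i
      using eq[OF that] by (simp add: real_apply_def flip: sum_divide_distrib)
  qed (use v m in auto)
qed

section \<open>Embeddings of bouquets\<close>

text \<open>The form of containment used from here on: maps can be modified vertex by vertex without
  naming the subgraph they produce.\<close>

definition embeds :: "'b graph \<Rightarrow> 'a graph \<Rightarrow> bool" where
  "embeds F G \<longleftrightarrow> (\<exists>f. inj_on f (vertices F) \<and> f ` vertices F \<subseteq> vertices G \<and>
     (\<forall>e\<in>edges F. f ` e \<in> edges G))"

lemma graph_free_iff_not_embeds: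
  assumes F: "simple_graph F" and G: "simple_graph G"
  shows "graph_free F G \<longleftrightarrow> \<not> embeds F G"
proof
  assume free: "graph_free F G"
  show "\<not> embeds F G"
  proof
    assume "embeds F G"
    then obtain f where f: "inj_on f (vertices F)" "f ` vertices F \<subseteq> vertices G"
      "\<forall>e\<in>edges F. f ` e \<in> edges G" unfolding embeds_def by auto
    let ?H = "(f ` vertices F, (\<lambda>e. f ` e) ` edges F)"
    have "card (f ` e) = 2" if "e \<in> edges F" for e
      using that F f(1) unfolding simple_graph_def by (metis card_image inj_on_subset)
    hence "simple_graph ?H" using F unfolding simple_graph_def by auto
    hence "subgraph ?H G" using G f unfolding subgraph_def by auto
    moreover have "graph_isomorphic F ?H"
      unfolding graph_isomorphic_def using f(1) by (auto intro!: exI[of _ f] simp: bij_betw_def)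
    ultimately show False using free unfolding graph_free_def by blast
  qed
next
  assume no: "\<not> embeds F G"
  show "graph_free F G" unfolding graph_free_def
  proof
    assume "\<exists>H. subgraph H G \<and> graph_isomorphic F H"
    then obtain H f where H: "subgraph H G" "bij_betw f (vertices F) (vertices H)"
      "edges H = (\<lambda>e. f ` e) ` edges F" unfolding graph_isomorphic_def by auto
    hence "embeds F G" unfolding embeds_def subgraph_def bij_betw_def by (intro exI[of _ f]) auto
    thus False using no by simp
  qed
qed

section \<open>Explicit description of bouquets and a linear numbering of their vertices\<close>

lemma vertices_cycle_bouquet:
  assumes "\<forall>t\<in>set ls. 3 \<le> t"
  shows "vertices (cycle_bouquet ls) = insert (0, 0) {(i, j). i < length ls \<and> 1 \<le> j \<and> j < ls ! i}"
proof -
  have "bouquet_vertex i ` {..<ls ! i} \<subseteq> insert (0, 0) {(i, j). i < length ls \<and> 1 \<le> j \<and> j < ls ! i}"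
    if "i < length ls" for i
    using that by (auto simp: bouquet_vertex_def)
  moreover have "(i, j) \<in> bouquet_vertex i ` {..<ls ! i}" if "1 \<le> j" "j < ls ! i" for i j
    using that by (intro image_eqI[of _ _ j]) (auto simp: bouquet_vertex_def)
  ultimately show ?thesis unfolding cycle_bouquet_def by fastforce
qed

text \<open>Resolves the cases of \<open>bouquet_vertex\<close> and the wrap-around of
  \<open>mod\<close>: the two edges of each cycle at the centre are separated from the path that
  remains when the centre is deleted.\<close>

lemma edges_cycle_bouquet:
  assumes "\<forall>t\<in>set ls. 3 \<le> t"
  shows "edges (cycle_bouquet ls) =
    (\<Union>i<length ls. {{(0, 0), (i, 1)}, {(i, ls ! i - 1), (0, 0)}} \<union>
       {{(i, j), (i, Suc j)} | j. 1 \<le> j \<and> Suc j < ls ! i})"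
proof -
  have "(\<lambda>j. {bouquet_vertex i j, bouquet_vertex i (Suc j mod l)}) ` {..<l} =
     {{(0, 0), (i, 1)}, {(i, l - 1), (0, 0)}} \<union> {{(i, j), (i, Suc j)} | j. 1 \<le> j \<and> Suc j < l}"
    (is "?g ` _ = ?R") if l: "3 \<le> l" for i l
  proof
    show "?g ` {..<l} \<subseteq> ?R"
    proof
      fix e assume "e \<in> ?g ` {..<l}"
      then obtain j where j: "j < l" "e = ?g j" by auto
      consider "j = 0" | "1 \<le> j" "Suc j < l" | "j = l - 1" using j by linarith
      thus "e \<in> ?R" using j l by cases (auto simp: bouquet_vertex_def)
    qed
    show "?R \<subseteq> ?g ` {..<l}"
    proof
      fix e assume "e \<in> ?R"
      then consider "e = {(0, 0), (i, 1)}" | "e = {(i, l - 1), (0, 0)}"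
        | j where "1 \<le> j" "Suc j < l" "e = {(i, j), (i, Suc j)}" by auto
      thus "e \<in> ?g ` {..<l}"
      proof cases
        case 1
        thus ?thesis using l by (intro image_eqI[of _ _ 0]) (auto simp: bouquet_vertex_def)
      next
        case 2
        thus ?thesis using l by (intro image_eqI[of _ _ "l - 1"]) (auto simp: bouquet_vertex_def)
      next
        case (3 j)
        thus ?thesis using l by (intro image_eqI[of _ _ j]) (auto simp: bouquet_vertex_def)
      qed
    qed
  qed
  moreover have "3 \<le> ls ! i" if "i < length ls" for i using that assms by auto
  ultimately show ?thesis unfolding cycle_bouquet_def snd_conv by (intro SUP_cong) auto
qed

lemma simple_graph_cycle_bouquet:
  assumes "\<forall>t\<in>set ls. 3 \<le> t"
  shows "simple_graph (cycle_bouquet ls)"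
proof -
  have "finite (vertices (cycle_bouquet ls))" by (simp add: cycle_bouquet_def)
  moreover have "e \<subseteq> vertices (cycle_bouquet ls) \<and> card e = 2" if e: "e \<in> edges (cycle_bouquet ls)" for e
  proof -
    consider i where "i < length ls" "e = {(0, 0), (i, 1)}"
      | i where "i < length ls" "e = {(i, ls ! i - 1), (0, 0)}"
      | i j where "i < length ls" "1 \<le> j" "Suc j < ls ! i" "e = {(i, j), (i, Suc j)}"
      using e unfolding edges_cycle_bouquet[OF assms] UN_iff Un_iff insert_iff empty_iff mem_Collect_eq
      by fast
    moreover have "3 \<le> ls ! i" if "i < length ls" for i using assms that by auto
    ultimately show ?thesis unfolding vertices_cycle_bouquet[OF assms]
      by cases fastforce+
  qed
  ultimately show ?thesis unfolding simple_graph_def by auto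
qed

text \<open>No cycle is longer than \<open>sum_list ls\<close>, so blocks of that width give the
  cycles disjoint stretches of one sequence; \<open>bouquet_index_inj\<close> is the
  disjointness.\<close>

lemma bouquet_index_less:
  assumes "i < length ls" "j < ls ! i"
  shows "i * sum_list ls + j < length ls * sum_list (ls :: nat list)"
proof -
  have "j < sum_list ls" using assms elem_le_sum_list[of i ls] by linarith
  moreover have "Suc i * sum_list ls \<le> length ls * sum_list ls"
    using assms by (intro mult_right_mono) auto
  ultimately show ?thesis by simp
qed

lemma bouquet_index_inj:
  assumes "i < length ls" "j < ls ! i" "i' < length ls" "j' < ls ! i'"
    and eq: "i * sum_list ls + j = i' * sum_list (ls :: nat list) + j'"
  shows "i = i' \<and> j = j'"
proof -
  have "j < sum_list ls" "j' < sum_list ls"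
    using assms elem_le_sum_list[of i ls] elem_le_sum_list[of i' ls] by linarith+
  moreover have "(c * m + d) div m = c" if "d < m" for c d m :: nat using that by simp
  ultimately have "i = i'" using eq by metis
  thus ?thesis using eq by simp
qed

section \<open>Finite graphs: neighbourhoods and counting of arcs\<close>

locale fin_graph =
  fixes G :: "'a graph"
  assumes simple: "simple_graph G"
begin

abbreviation "V \<equiv> vertices G"

definition adj :: "'a \<Rightarrow> 'a \<Rightarrow> bool" where "adj u v \<longleftrightarrow> {u, v} \<in> edges G"

definition nb :: "'a \<Rightarrow> 'a set" where "nb v = {u. adj v u}"

text \<open>Ordered pairs are counted, so \<open>arcs X X\<close> is twice the number of edges
  inside \<open>X\<close>, while for disjoint sets each cross edge counts once.\<close>

definition arcs :: "'a set \<Rightarrow> 'a set \<Rightarrow> nat" where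
  "arcs X Y = card {(u, v). u \<in> X \<and> v \<in> Y \<and> adj u v}"

lemma finite_V [simp]: "finite V" using simple by (simp add: simple_graph_def)

lemma adj_sym: "adj u v \<longleftrightarrow> adj v u" by (simp add: adj_def insert_commute)

lemma adj_irrefl [simp]: "\<not> adj u u" using simple by (auto simp: adj_def simple_graph_def)

lemma adj_V: "adj u v \<Longrightarrow> u \<in> V \<and> v \<in> V" using simple by (fastforce simp: adj_def simple_graph_def)

lemma in_nb [simp]: "u \<in> nb v \<longleftrightarrow> adj v u" by (simp add: nb_def)

lemma nb_subset: "nb v \<subseteq> V" using adj_V by auto

lemma finite_nb [simp]: "finite (nb v)" using finite_subset[OF nb_subset] by simp

lemma arcs_eq_sum:
  assumes "finite X"
  shows "arcs X Y = (\<Sum>u\<in>X. card (nb u \<inter> Y))"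
proof -
  have "{(u, v). u \<in> X \<and> v \<in> Y \<and> adj u v} = Sigma X (\<lambda>u. nb u \<inter> Y)" by auto
  thus ?thesis unfolding arcs_def using assms by (simp add: card_SigmaI)
qed

lemma arcs_commute: "arcs X Y = arcs Y X"
proof -
  have "{(u, v). u \<in> Y \<and> v \<in> X \<and> adj u v} = prod.swap ` {(u, v). u \<in> X \<and> v \<in> Y \<and> adj u v}"
    using adj_sym by (auto simp: image_iff)
  thus ?thesis unfolding arcs_def by (simp add: card_image)
qed

lemma arcs_Un_left:
  assumes "finite X" "finite Y" "X \<inter> Y = {}"
  shows "arcs (X \<union> Y) Z = arcs X Z + arcs Y Z"
  using assms by (simp add: arcs_eq_sum sum.union_disjoint)

lemma arcs_Un_right:
  assumes "finite X" "finite Y" "X \<inter> Y = {}"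
  shows "arcs Z (X \<union> Y) = arcs Z X + arcs Z Y"
  using arcs_Un_left[OF assms] by (simp add: arcs_commute)

lemma arcs_mono: 
  assumes "finite X'" "finite Y'" "X \<subseteq> X'" "Y \<subseteq> Y'" 
  shows "arcs X Y \<le> arcs X' Y'"
proof -
  have "{(u, v). u \<in> X' \<and> v \<in> Y' \<and> adj u v} \<subseteq> X' \<times> Y'" by auto
  thus ?thesis unfolding arcs_def
    using assms by (intro card_mono) (auto intro: finite_subset)
qed

lemma arcs_VV: "arcs V V = 2 * card (edges G)"
proof -
  have fin: "finite (edges G)"
    by (rule finite_subset[of _ "Pow V"]) (use simple in \<open>auto simp: simple_graph_def\<close>)
  have "{(u, v). u \<in> V \<and> v \<in> V \<and> adj u v} = (\<Union>e\<in>edges G. {(u, v). {u, v} = e})"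
    using adj_V by (auto simp: adj_def)
  moreover have "card (\<Union>e\<in>edges G. {(u, v). {u, v} = e}) = (\<Sum>e\<in>edges G. card {(u, v). {u, v} = e})"
  proof (rule card_UN_disjoint)
    show "\<forall>e\<in>edges G. finite {(u, v). {u, v} = e}"
    proof
      fix e assume "e \<in> edges G"
      hence "{(u, v). {u, v} = e} \<subseteq> V \<times> V" using simple by (auto simp: simple_graph_def)
      thus "finite {(u, v). {u, v} = e}" by (rule finite_subset) simp
    qed
  next
    show "\<forall>e\<in>edges G. \<forall>e'\<in>edges G. e \<noteq> e' \<longrightarrow> {(u, v). {u, v} = e} \<inter> {(u, v). {u, v} = e'} = {}"
      by blast
  qed (rule fin)
  moreover have "card {(u, v). {u, v} = e} = 2" if "e \<in> edges G" for e
  proof -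
    have "card e = 2" using that simple by (simp add: simple_graph_def)
    then obtain a b where "e = {a, b}" "a \<noteq> b" by (auto simp: card_2_iff)
    hence "{(u, v). {u, v} = e} = {(a, b), (b, a)}" by (auto simp: doubleton_eq_iff)
    thus ?thesis using \<open>a \<noteq> b\<close> by simp
  qed
  ultimately show ?thesis by (simp add: arcs_def)
qed

section \<open>Long paths in dense sets, and sparseness of neighbourhoods\<close>

definition path_in :: "'a set \<Rightarrow> nat \<Rightarrow> (nat \<Rightarrow> 'a) \<Rightarrow> bool" where
  "path_in X m p \<longleftrightarrow> inj_on p {..<m} \<and> p ` {..<m} \<subseteq> X \<and> (\<forall>i. Suc i < m \<longrightarrow> adj (p i) (p (Suc i)))"

text \<open>Greedy extension. Here \<open>m\<close> counts vertices: as long as fewer than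
  \<open>N\<close> are used, the last one has a neighbour in \<open>X\<close> off the path.\<close>

lemma min_degree_imp_path:
  assumes "X \<noteq> {}" "\<And>v. v \<in> X \<Longrightarrow> N \<le> card (nb v \<inter> X)" "m \<le> N"
  shows "\<exists>p. path_in X m p"
  using assms(3)
proof (induction m)
  case 0
  show ?case by (simp add: path_in_def)
next
  case (Suc m)
  then obtain p where p: "path_in X m p" by auto
  show ?case
  proof (cases m)
    case 0
    obtain v where "v \<in> X" using assms(1) by auto
    thus ?thesis using 0 by (intro exI[of _ "\<lambda>_. v"]) (auto simp: path_in_def inj_on_def)
  next
    case (Suc k)
    hence "p k \<in> X" using p by (auto simp: path_in_def)
    hence "card (p ` {..<m}) < card (nb (p k) \<inter> X)"
      using assms(2) \<open>Suc m \<le> N\<close> card_image_le[of "{..<m}" p]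
      by (metis Suc_le_eq card_lessThan finite_lessThan le_trans le_less_trans)
    hence "\<not> nb (p k) \<inter> X \<subseteq> p ` {..<m}" by (meson card_mono finite_imageI finite_lessThan leD)
    then obtain y where y: "y \<in> nb (p k)" "y \<in> X" "y \<notin> p ` {..<m}" by blast
    have "path_in X (Suc m) (p(m := y))" unfolding path_in_def
    proof (intro conjI allI impI)
      show "inj_on (p(m := y)) {..<Suc m}"
        using p y(3) unfolding path_in_def lessThan_Suc by (simp add: inj_on_fun_updI)
      show "p(m := y) ` {..<Suc m} \<subseteq> X" using p y(2) by (auto simp: path_in_def less_Suc_eq)
      fix i assume "Suc i < Suc m"
      thus "adj ((p(m := y)) i) ((p(m := y)) (Suc i))"
        using p y(1) Suc by (cases "i = k") (auto simp: path_in_def)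
    qed
    thus ?thesis by auto
  qed
qed

text \<open>Deleting a vertex with fewer than \<open>N\<close> neighbours in \<open>X\<close>
  destroys fewer than \<open>2 * N\<close> arcs, so the density hypothesis survives; it fails for
  the empty set, so the deletions stop at a set of minimum degree \<open>N\<close>.\<close>

lemma dense_imp_path:
  assumes "finite X" "2 * N * card X < arcs X X"
  shows "\<exists>p. path_in X N p"
  using assms
proof (induction X rule: finite_psubset_induct)
  case (psubset X)
  have "X \<noteq> {}" using psubset.prems by (auto simp: arcs_eq_sum)
  show ?case
  proof (cases "\<forall>v\<in>X. N \<le> card (nb v \<inter> X)")
    case True
    thus ?thesis using min_degree_imp_path[OF \<open>X \<noteq> {}\<close>, of N N] by blast
  next
    case False
    then obtain v where v: "v \<in> X" "card (nb v \<inter> X) < N" by force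
    let ?Y = "X - {v}"
    have X: "{v} \<union> ?Y = X" using v by auto
    have deg: "arcs {v} X = card (nb v \<inter> X)" by (simp add: arcs_eq_sum)
    have "arcs X X = arcs {v} X + arcs ?Y X"
      using arcs_Un_left[of "{v}" ?Y X] psubset.hyps unfolding X by simp
    moreover have "arcs ?Y X = arcs ?Y {v} + arcs ?Y ?Y"
      using arcs_Un_right[of "{v}" ?Y ?Y] psubset.hyps unfolding X by simp
    moreover have "arcs ?Y {v} \<le> arcs {v} X"
      using psubset.hyps by (subst arcs_commute, intro arcs_mono) auto
    ultimately have "arcs X X \<le> 2 * card (nb v \<inter> X) + arcs ?Y ?Y" using deg by linarith
    moreover have "card X = Suc (card ?Y)" using v psubset.hyps by (metis card_Suc_Diff1)
    ultimately have "2 * N * card ?Y < arcs ?Y ?Y" using psubset.prems v(2) by (simp add: algebra_simps)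
    moreover have "?Y \<subset> X" using v by auto
    ultimately obtain p where "path_in ?Y N p" using psubset.IH by blast
    thus ?thesis by (intro exI[of _ p]) (auto simp: path_in_def)
  qed
qed

lemma embeds_cycle_bouquetI:
  assumes "\<forall>t\<in>set ls. 3 \<le> t"
    and "inj_on f (insert (0, 0) {(i, j). i < length ls \<and> 1 \<le> j \<and> j < ls ! i})"
    and "f (0, 0) \<in> V"
    and "\<And>i. i < length ls \<Longrightarrow> adj (f (0, 0)) (f (i, 1)) \<and> adj (f (0, 0)) (f (i, ls ! i - 1))"
    and "\<And>i j. i < length ls \<Longrightarrow> 1 \<le> j \<Longrightarrow> Suc j < ls ! i \<Longrightarrow> adj (f (i, j)) (f (i, Suc j))"
  shows "embeds (cycle_bouquet ls) G"
  unfolding embeds_def edges_cycle_bouquet[OF assms(1)] vertices_cycle_bouquet[OF assms(1)]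
proof (intro exI[of _ f] conjI)
  have "f (i, j) \<in> V" if "i < length ls" "1 \<le> j" "j < ls ! i" for i j
  proof (cases "Suc j < ls ! i")
    case False
    hence "j = ls ! i - 1" using that by simp
    thus ?thesis using assms(4) that adj_V by blast
  qed (use assms(5) that adj_V in blast)
  thus "f ` insert (0, 0) {(i, j). i < length ls \<and> 1 \<le> j \<and> j < ls ! i} \<subseteq> V" using assms(3) by auto
next
  show "\<forall>e\<in>\<Union>i<length ls. {{(0, 0), (i, 1)}, {(i, ls ! i - 1), (0, 0)}} \<union>
       {{(i, j), (i, Suc j)} | j. 1 \<le> j \<and> Suc j < ls ! i}. f ` e \<in> edges G"
  proof
    fix e assume "e \<in> (\<Union>i<length ls. {{(0, 0), (i, 1)}, {(i, ls ! i - 1), (0, 0)}} \<union>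
       {{(i, j), (i, Suc j)} | j. 1 \<le> j \<and> Suc j < ls ! i})"
    then consider i where "i < length ls" "e = {(0, 0), (i, 1)} \<or> e = {(0, 0), (i, ls ! i - 1)}"
      | i j where "i < length ls" "1 \<le> j" "Suc j < ls ! i" "e = {(i, j), (i, Suc j)}"
      by (auto simp: insert_commute)
    thus "f ` e \<in> edges G"
    proof cases
      case 1
      thus ?thesis using assms(4) by (auto simp: adj_def)
    next
      case 2
      thus ?thesis using assms(5) by (auto simp: adj_def)
    qed
  qed
qed (rule assms(2))

text \<open>The \<open>i\<close>-th cycle uses the stretch of the path that starts after position \<open>i * sum_list ls\<close>.\<close>

lemma path_in_nb_imp_embeds:
  assumes ls: "\<forall>t\<in>set ls. 3 \<le> t" and p: "path_in (nb v) (length ls * sum_list ls + 1) p" and v: "v \<in> V"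
  shows "embeds (cycle_bouquet ls) G"
proof -
  let ?m = "sum_list ls"
  define f where "f = (\<lambda>(i, j). if j = 0 then v else p (i * ?m + j))"
  have lt: "i * ?m + j < length ls * ?m + 1" if "i < length ls" "j < ls ! i" for i j
    using bouquet_index_less[OF that] by simp
  have nbp: "adj v (p k)" if "k < length ls * ?m + 1" for k using p that unfolding path_in_def by auto
  show ?thesis
  proof (rule embeds_cycle_bouquetI[OF ls, of f])
    show "inj_on f (insert (0, 0) {(i, j). i < length ls \<and> 1 \<le> j \<and> j < ls ! i})"
    proof -
      have ne: "f (i, j) \<noteq> v" if "i < length ls" "1 \<le> j" "j < ls ! i" for i j
        using nbp[OF lt[OF that(1,3)]] that(2) unfolding f_def by auto
      have "i = i' \<and> j = j'" if "i < length ls" "1 \<le> j" "j < ls ! i" "i' < length ls" "1 \<le> j'" "j' < ls ! i'"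
        "f (i, j) = f (i', j')" for i j i' j'
      proof -
        have "p (i * ?m + j) = p (i' * ?m + j')" using that by (auto simp: f_def)
        hence eq: "i * ?m + j = i' * ?m + j'"
          using p lt that unfolding path_in_def inj_on_def by auto
        thus ?thesis using bouquet_index_inj[OF that(1,3,4,6)] by simp
      qed
      thus ?thesis using ne by (fastforce simp: inj_on_def f_def)
    qed
    show "f (0, 0) \<in> V" using v by (simp add: f_def)
    fix i assume i: "i < length ls"
    hence "3 \<le> ls ! i" using ls by auto
    thus "adj (f (0, 0)) (f (i, 1)) \<and> adj (f (0, 0)) (f (i, ls ! i - 1))"
      using nbp[OF lt[OF i, of 1]] nbp[OF lt[OF i, of "ls ! i - 1"]] by (simp add: f_def)
    show "adj (f (i, j)) (f (i, Suc j))" if "1 \<le> j" "Suc j < ls ! i" for j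
      using lt[OF i that(2)] p that unfolding path_in_def f_def by auto
  qed
qed

text \<open>A denser neighbourhood would contain a path long enough to hold all cycles of the
  bouquet once \<open>v\<close> is taken as the centre.\<close>

lemma nb_arcs_le:
  assumes ls: "\<forall>t\<in>set ls. 3 \<le> t" and "\<not> embeds (cycle_bouquet ls) G" "v \<in> V"
  shows "arcs (nb v) (nb v) \<le> 2 * (length ls * sum_list ls + 1) * card (nb v)"
proof (rule ccontr)
  assume "\<not> ?thesis"
  then obtain p where "path_in (nb v) (length ls * sum_list ls + 1) p"
    using dense_imp_path[OF finite_nb, of "length ls * sum_list ls + 1" v] by auto
  thus False using path_in_nb_imp_embeds[OF ls _ assms(3)] assms(2) by blast
qed

section \<open>Replacing neighbourhoods, of one vertex to bound weights or of many to move them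
  between parts\<close>

definition relink :: "'a set \<Rightarrow> 'a set \<Rightarrow> 'a graph" where
  "relink J W = (V, {e \<in> edges G. e \<inter> J = {}} \<union> {{u, w} | u w. u \<in> J \<and> w \<in> W})"

lemma simple_relink:
  assumes "J \<subseteq> V" "W \<subseteq> V" "J \<inter> W = {}"
  shows "simple_graph (relink J W)"
proof -
  have "e \<subseteq> V \<and> card e = 2" if e: "e \<in> edges (relink J W)" for e
  proof -
    consider "e \<in> edges G" | u w where "u \<in> J" "w \<in> W" "e = {u, w}"
      using e by (auto simp: relink_def)
    thus ?thesis
    proof cases
      case 1
      thus ?thesis using simple by (auto simp: simple_graph_def)
    next
      case (2 u w)
      hence "u \<noteq> w" using assms by auto
      thus ?thesis using 2 assms by auto
    qed
  qed
  thus ?thesis by (simp add: simple_graph_def relink_def)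
qed

lemma edge_relink_iff:
  "{u, v} \<in> edges (relink J W) \<longleftrightarrow>
     (u \<notin> J \<and> v \<notin> J \<and> adj u v) \<or> (u \<in> J \<and> v \<in> W) \<or> (v \<in> J \<and> u \<in> W)"
  by (auto simp: relink_def adj_def doubleton_eq_iff)

text \<open>In a copy of \<open>F\<close> that uses vertices of \<open>J\<close>, these can be exchanged for common neighbours of
  the vertices of the copy that lie in \<open>W\<close>.\<close>

lemma embeds_relink:
  assumes F: "simple_graph F" and disj: "J \<inter> W = {}"
    and common: "\<And>X. X \<subseteq> W \<Longrightarrow> finite X \<Longrightarrow> card X \<le> card (vertices F) \<Longrightarrow>
       card (vertices F) \<le> card {u \<in> V - J. \<forall>w\<in>X. adj u w}"
    and "embeds F (relink J W)"
  shows "embeds F G"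
proof -
  let ?VF = "vertices F"
  have finF: "finite ?VF" using F by (simp add: simple_graph_def)
  obtain f where f: "inj_on f ?VF" "f ` ?VF \<subseteq> V" "\<forall>e\<in>edges F. f ` e \<in> edges (relink J W)"
    using assms(4) unfolding embeds_def by (auto simp: relink_def)
  define I where "I = {u \<in> ?VF. f u \<in> J}"
  define X where "X = f ` ?VF \<inter> W"
  \<comment> \<open>The candidates for the exchange must also avoid the rest of the copy. At least
    \<open>card ?VF - (card ?VF - card I) = card I\<close> of them remain.\<close>
  define K where "K = {u \<in> V - J. \<forall>w\<in>X. adj u w} - f ` (?VF - I)"
  have IF: "I \<subseteq> ?VF" by (auto simp: I_def)
  have finI: "finite I" using finF IF finite_subset by blast
  have "card X \<le> card ?VF" unfolding X_def
    by (rule order_trans[OF card_mono card_image_le]) (use finF in auto)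
  hence "card ?VF \<le> card {u \<in> V - J. \<forall>w\<in>X. adj u w}"
    using finF by (intro common) (auto simp: X_def)
  moreover have "card (f ` (?VF - I)) \<le> card ?VF - card I"
    using card_image_le[of "?VF - I" f] finF card_Diff_subset[OF finI IF] by simp
  moreover have "card I \<le> card ?VF" using finF IF by (rule card_mono)
  moreover have "card {u \<in> V - J. \<forall>w\<in>X. adj u w} - card (f ` (?VF - I)) \<le> card K"
    unfolding K_def by (rule diff_card_le_card_Diff) (use finF in auto)
  ultimately have "card I \<le> card K" by linarith
  moreover have "finite K" by (simp add: K_def)
  ultimately obtain h where h: "h ` I \<subseteq> K" "inj_on h I" using card_le_inj[OF finI] by blast
  define g where "g u = (if u \<in> I then h u else f u)" for u
  have gI: "g u \<in> K" if "u \<in> I" for u using that h by (auto simp: g_def)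
  have gF: "g u = f u" if "u \<notin> I" for u using that by (auto simp: g_def)
  \<comment> \<open>In the relinked graph an edge at a vertex of \<open>J\<close> ends in
    \<open>W\<close>; that end is not exchanged, and every element of \<open>K\<close> is adjacent
    to it.\<close>
  have cross: "adj (g u) (g w)" if uw: "u \<in> I" "w \<in> ?VF" "{f u, f w} \<in> edges (relink J W)" for u w
  proof -
    have fw: "f w \<in> W" "f w \<notin> J"
      using uw disj unfolding edge_relink_iff by (auto simp: I_def)
    hence "w \<notin> I" "f w \<in> X" using uw(2) by (auto simp: I_def X_def)
    thus ?thesis using gI[OF uw(1)] gF by (simp add: K_def)
  qed
  show ?thesis unfolding embeds_def
  proof (intro exI[of _ g] conjI ballI)
    show "inj_on g ?VF"
    proof (rule inj_onI)
      fix u w assume uw: "u \<in> ?VF" "w \<in> ?VF" "g u = g w"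
      have "g a \<noteq> g b" if "a \<in> I" "b \<in> ?VF - I" for a b
        using gI[OF that(1)] that(2) gF[of b] by (auto simp: K_def)
      hence "u \<in> I \<longleftrightarrow> w \<in> I" using uw by (metis DiffI)
      thus "u = w" using uw h(2) f(1) by (cases "u \<in> I") (auto simp: g_def inj_on_def)
    qed
    show "g ` ?VF \<subseteq> V"
    proof safe
      fix u assume "u \<in> ?VF"
      thus "g u \<in> V" using gI[of u] gF[of u] f(2) by (cases "u \<in> I") (auto simp: K_def)
    qed
    fix e assume e: "e \<in> edges F"
    hence "card e = 2" "e \<subseteq> ?VF" using F by (auto simp: simple_graph_def)
    then obtain u w where uw: "e = {u, w}" "u \<in> ?VF" "w \<in> ?VF" by (auto simp: card_2_iff)
    have fe: "{f u, f w} \<in> edges (relink J W)" using f(3) e uw by auto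
    have "adj (g u) (g w)"
    proof (cases "u \<in> I \<or> w \<in> I")
      case True
      thus ?thesis using cross[of u w] cross[of w u] fe uw adj_sym by (auto simp: insert_commute)
    next
      case False
      hence "f u \<notin> J" "f w \<notin> J" using uw by (auto simp: I_def)
      thus ?thesis using fe False gF unfolding edge_relink_iff by simp
    qed
    thus "g ` e \<in> edges G" using uw by (simp add: adj_def)
  qed
qed

section \<open>Building the bouquet from a matching inside one part\<close>

lemma card_common_nb:
  assumes "finite U" "\<And>u. u \<in> U \<Longrightarrow> card (T - nb u) \<le> D" "finite T"
  shows "card T \<le> card {t \<in> T. \<forall>u\<in>U. adj t u} + card U * D"
proof -
  \<comment> \<open>A union bound: each \<open>u\<close> excludes at most \<open>D\<close> elements
    of \<open>T\<close>.\<close>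
  have "T \<subseteq> {t \<in> T. \<forall>u\<in>U. adj t u} \<union> (\<Union>u\<in>U. T - nb u)" using adj_sym by auto
  hence "card T \<le> card ({t \<in> T. \<forall>u\<in>U. adj t u} \<union> (\<Union>u\<in>U. T - nb u))"
    using assms by (intro card_mono) auto
  also have "\<dots> \<le> card {t \<in> T. \<forall>u\<in>U. adj t u} + card (\<Union>u\<in>U. T - nb u)" by (rule card_Un_le)
  also have "card (\<Union>u\<in>U. T - nb u) \<le> (\<Sum>u\<in>U. card (T - nb u))" using assms by (intro card_UN_le)
  also have "\<dots> \<le> card U * D" using sum_bounded_above[of U "\<lambda>u. card (T - nb u)" D] assms by simp
  finally show ?thesis by simp
qed

lemma obtain_injection:
  assumes "m \<le> card A" "finite A"
  obtains p where "inj_on p {..<m}" "p ` {..<m} \<subseteq> A"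
  using card_le_inj[of "{..<m}" A] assms by auto

text \<open>The centre is chosen in \<open>T\<close>; the \<open>i\<close>-th cycle leaves it for the matching edge \<open>\<alpha> i, \<beta> i\<close>, which
  makes its length odd, and then alternates between \<open>T\<close> and \<open>S\<close>.\<close>

lemma matching_imp_embeds:
  assumes ls: "\<forall>t\<in>set ls. odd t \<and> 3 \<le> t" and ST: "S \<subseteq> V" "T \<subseteq> V" "S \<inter> T = {}"
    and SD: "\<And>v. v \<in> S \<Longrightarrow> card (T - nb v) \<le> D" and TD: "\<And>v. v \<in> T \<Longrightarrow> card (S - nb v) \<le> D"
    and M: "M = length ls * sum_list ls"
    and big: "M + 1 + 2 * length ls * D \<le> card T" "M + 2 * length ls + (M + 1) * D \<le> card S"
    and \<alpha>\<beta>: "inj_on \<alpha> {..<length ls}" "inj_on \<beta> {..<length ls}"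
      "\<alpha> ` {..<length ls} \<subseteq> S" "\<beta> ` {..<length ls} \<subseteq> S"
      "\<alpha> ` {..<length ls} \<inter> \<beta> ` {..<length ls} = {}"
      "\<And>i. i < length ls \<Longrightarrow> adj (\<alpha> i) (\<beta> i)"
  shows "embeds (cycle_bouquet ls) G"
proof -
  let ?r = "length ls" and ?m = "sum_list ls"
  define U where "U = \<alpha> ` {..<?r} \<union> \<beta> ` {..<?r}"
  have fin: "finite S" "finite T" using ST by (auto intro: finite_subset)
  have U: "finite U" "U \<subseteq> S" using \<alpha>\<beta> by (auto simp: U_def)
  have cU: "card U \<le> 2 * ?r"
    unfolding U_def using card_image_le[of "{..<?r}" \<alpha>] card_image_le[of "{..<?r}" \<beta>]
    by (intro order_trans[OF card_Un_le]) simp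
  define TU where "TU = {t \<in> T. \<forall>u\<in>U. adj t u}"
  have "card T \<le> card TU + card U * D"
    unfolding TU_def using U SD fin by (intro card_common_nb) auto
  also have "card U * D \<le> 2 * ?r * D" using cU by (intro mult_right_mono) auto
  finally have cTU: "M + 1 \<le> card TU" using big(1) by simp
  have finTU: "finite TU" using fin by (simp add: TU_def)
  obtain q where q: "inj_on q {..<M + 1}" "q ` {..<M + 1} \<subseteq> TU"
    using obtain_injection[OF cTU finTU] by blast
  \<comment> \<open>Cycle positions receive numbers below \<open>M\<close>, so index
    \<open>M\<close> of \<open>q\<close> is free for the centre.\<close>
  define c where "c = q M"
  define SQ where "SQ = {s \<in> S. \<forall>t\<in>q ` {..<M + 1}. adj s t}"
  have "card S \<le> card SQ + card (q ` {..<M + 1}) * D"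
    unfolding SQ_def using q(2) TD fin by (intro card_common_nb) (auto simp: TU_def)
  also have "card (q ` {..<M + 1}) = M + 1" using card_image[OF q(1)] by simp
  finally have "M + 2 * ?r \<le> card SQ" using big(2) by linarith
  moreover have "card SQ - card U \<le> card (SQ - U)" by (rule diff_card_le_card_Diff[OF U(1)])
  ultimately have cSQ: "M \<le> card (SQ - U)" using cU by linarith
  have finSQ: "finite (SQ - U)" using fin by (simp add: SQ_def)
  obtain p where p: "inj_on p {..<M}" "p ` {..<M} \<subseteq> SQ - U"
    using obtain_injection[OF cSQ finSQ] by blast
  have qU: "adj (q k) u" if "k \<le> M" "u \<in> U" for k u
    using that q(2) unfolding TU_def by (auto simp: image_subset_iff)
  have pq: "adj (p k) (q l)" if "k < M" "l \<le> M" for k l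
    using that p(2) unfolding SQ_def by (auto simp: image_subset_iff)
  have inU: "\<alpha> i \<in> U" "\<beta> i \<in> U" if "i < ?r" for i using that by (auto simp: U_def)
  have lt: "i * ?m + j < M" if "i < ?r" "j < ls ! i" for i j
    unfolding M using that by (rule bouquet_index_less)
  \<comment> \<open>From position 3 on, odd positions lie in \<open>T\<close> and even ones in
    \<open>S\<close>. The last position of an odd cycle is even, so it lies in \<open>S\<close> and
    is joined to the centre in \<open>T\<close>; for a triangle it is
    \<open>\<beta> i\<close>.\<close>
  define f where "f = (\<lambda>(i, j). if j = 0 then c else if j = 1 then \<alpha> i else if j = 2 then \<beta> i
     else if odd j then q (i * ?m + j) else p (i * ?m + j))"
  have qT: "q k \<in> T" if "k \<le> M" for k using that q(2) by (auto simp: TU_def image_subset_iff)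
  have pS: "p k \<in> S" "p k \<notin> U" if "k < M" for k using that p(2) by (auto simp: SQ_def image_subset_iff)
  have inj: "i = i' \<and> j = j'"
    if ij: "i < ?r" "1 \<le> j" "j < ls ! i" and ij': "i' < ?r" "1 \<le> j'" "j' < ls ! i'"
      and eq: "f (i, j) = f (i', j')" for i j i' j'
  proof -
    have kinds: "(f (a, b) = \<alpha> a \<and> b = 1) \<or> (f (a, b) = \<beta> a \<and> b = 2) \<or>
        (f (a, b) = q (a * ?m + b) \<and> 3 \<le> b) \<or> (f (a, b) = p (a * ?m + b) \<and> 3 \<le> b)"
      if "1 \<le> b" for a b using that by (auto simp: f_def)
    have l: "i * ?m + j < M" "i' * ?m + j' < M" using lt ij ij' by auto
    have disj: "\<alpha> a \<noteq> \<beta> b" "\<alpha> a \<noteq> q k" "\<alpha> a \<noteq> p k" "\<beta> a \<noteq> q k" "\<beta> a \<noteq> p k" "p k \<noteq> q k'"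
      if "a < ?r" "b < ?r" "k < M" "k' < M" for a b k k'
    proof -
      show "\<alpha> a \<noteq> \<beta> b" using \<alpha>\<beta>(5) that by blast
      show "\<alpha> a \<noteq> q k" "\<beta> a \<noteq> q k" using inU[OF that(1)] U(2) qT[of k] ST(3) that(3) by force+
      show "\<alpha> a \<noteq> p k" "\<beta> a \<noteq> p k" using inU[OF that(1)] pS[of k] that(3) by force+
      show "p k \<noteq> q k'" using pS(1)[of k] qT[of k'] ST(3) that(3,4) by force
    qed
    have inj_q: "k = k'" if "q k = q k'" "k < M" "k' < M" for k k' using q(1) that by (auto simp: inj_on_def)
    have inj_p: "k = k'" if "p k = p k'" "k < M" "k' < M" for k k' using p(1) that by (auto simp: inj_on_def)
    have inj_ab: "\<alpha> i = \<alpha> i' \<Longrightarrow> i = i'" "\<beta> i = \<beta> i' \<Longrightarrow> i = i'"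
      using \<alpha>\<beta>(1,2) ij(1) ij'(1) by (auto simp: inj_on_def)
    note d = disj[OF ij(1) ij'(1) l(2) l(1)] disj[OF ij'(1) ij(1) l(1) l(2)]
    show ?thesis
      using kinds[OF ij(2), of i] kinds[OF ij'(2), of i']
      apply (elim disjE conjE)
      using eq d inj_ab inj_q[OF _ l] inj_p[OF _ l] bouquet_index_inj[OF ij(1,3) ij'(1,3)] by metis+
  qed
  have ne: "f (i, j) \<noteq> c" if "i < ?r" "1 \<le> j" "j < ls ! i" for i j
  proof -
    have "i * ?m + j < M" using lt that by auto
    moreover have "q k \<noteq> c" if "k < M" for k using q(1) that by (auto simp: c_def inj_on_def)
    moreover have "c \<notin> S" using qT[of M] ST(3) by (auto simp: c_def)
    ultimately show ?thesis using that pS(1) inU[OF that(1)] U(2) by (auto simp: f_def)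
  qed
  show ?thesis
  proof (rule embeds_cycle_bouquetI[of ls f])
    show "\<forall>t\<in>set ls. 3 \<le> t" using ls by auto
    show "inj_on f (insert (0, 0) {(i, j). i < ?r \<and> 1 \<le> j \<and> j < ls ! i})"
    proof (rule inj_onI)
      fix a b assume a: "a \<in> insert (0, 0) {(i, j). i < ?r \<and> 1 \<le> j \<and> j < ls ! i}"
        and b: "b \<in> insert (0, 0) {(i, j). i < ?r \<and> 1 \<le> j \<and> j < ls ! i}" and eq: "f a = f b"
      have "f (0, 0) = c" by (simp add: f_def)
      thus "a = b" using a b eq ne inj by (cases a; cases b) (auto; metis)
    qed
    show "f (0, 0) \<in> V" using qT[of M] ST(2) by (auto simp: f_def c_def)
    fix i assume i: "i < ?r"
    hence li: "odd (ls ! i)" "3 \<le> ls ! i" using ls by auto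
    show "adj (f (0, 0)) (f (i, 1)) \<and> adj (f (0, 0)) (f (i, ls ! i - 1))"
    proof
      show "adj (f (0, 0)) (f (i, 1))" using qU[of M] inU[OF i] by (simp add: f_def c_def)
      show "adj (f (0, 0)) (f (i, ls ! i - 1))"
      proof (cases "ls ! i = 3")
        case True
        thus ?thesis using qU[of M] inU[OF i] by (simp add: f_def c_def)
      next
        case False
        have "adj (p (i * ?m + (ls ! i - 1))) c"
          unfolding c_def using li by (intro pq lt[OF i]) auto
        moreover have "f (i, ls ! i - 1) = p (i * ?m + (ls ! i - 1))" using False li by (auto simp: f_def)
        moreover have "f (0, 0) = c" by (simp add: f_def)
        ultimately show ?thesis using adj_sym by simp
      qed
    qed
    fix j assume j: "1 \<le> j" "Suc j < ls ! i"
    have l: "i * ?m + j < M" "i * ?m + Suc j < M" using lt[OF i, of j] lt[OF i, of "Suc j"] j by auto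
    consider "j = 1" | "j = 2" | "3 \<le> j" "odd j" | "3 \<le> j" "even j" using j by linarith
    thus "adj (f (i, j)) (f (i, Suc j))"
    proof cases
      case 1
      thus ?thesis using \<alpha>\<beta>(6)[OF i] by (simp add: f_def)
    next
      case 2
      thus ?thesis using qU[of "i * ?m + 3" "\<beta> i"] l inU[OF i] adj_sym by (simp add: f_def)
    next
      case 3
      thus ?thesis using pq[of "i * ?m + Suc j" "i * ?m + j"] l adj_sym by (simp add: f_def)
    next
      case 4
      thus ?thesis using pq[of "i * ?m + j" "i * ?m + Suc j"] l by (simp add: f_def)
    qed
  qed
qed

text \<open>Greedy choice: \<open>k\<close> matching edges cover at most \<open>2 * k\<close>
  vertices, which meet at most \<open>4 * k * D\<close> arcs in either direction, so for
  \<open>k < r\<close> an arc disjoint from them is left.\<close>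

lemma arcs_imp_matching:
  assumes S: "finite S" and deg: "\<And>v. v \<in> S \<Longrightarrow> card (nb v \<inter> S) \<le> D"
    and "4 * r * D < arcs S S" "k \<le> r"
  shows "\<exists>\<alpha> \<beta>. inj_on \<alpha> {..<k} \<and> inj_on \<beta> {..<k} \<and> \<alpha> ` {..<k} \<subseteq> S \<and> \<beta> ` {..<k} \<subseteq> S \<and>
    \<alpha> ` {..<k} \<inter> \<beta> ` {..<k} = {} \<and> (\<forall>i<k. adj (\<alpha> i) (\<beta> i))"
  using assms(4)
proof (induction k)
  case 0
  show ?case by simp
next
  case (Suc k)
  then obtain \<alpha> \<beta> where \<alpha>\<beta>: "inj_on \<alpha> {..<k}" "inj_on \<beta> {..<k}" "\<alpha> ` {..<k} \<subseteq> S" "\<beta> ` {..<k} \<subseteq> S"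
    "\<alpha> ` {..<k} \<inter> \<beta> ` {..<k} = {}" "\<forall>i<k. adj (\<alpha> i) (\<beta> i)" by auto
  define U where "U = \<alpha> ` {..<k} \<union> \<beta> ` {..<k}"
  have U: "finite U" "U \<subseteq> S" using \<alpha>\<beta> by (auto simp: U_def)
  have "card U \<le> 2 * k"
    unfolding U_def using card_image_le[of "{..<k}" \<alpha>] card_image_le[of "{..<k}" \<beta>]
    by (intro order_trans[OF card_Un_le]) simp
  hence "card U * D \<le> 2 * r * D" using Suc.prems by (intro mult_right_mono) auto
  moreover have "arcs U S \<le> card U * D"
    using sum_bounded_above[of U "\<lambda>u. card (nb u \<inter> S)" D] deg U by (auto simp: arcs_eq_sum)
  ultimately have US: "arcs U S \<le> 2 * r * D" by linarith
  have un: "U \<union> (S - U) = S" using U by auto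
  have "arcs S S = arcs U S + arcs (S - U) S"
    using arcs_Un_left[of U "S - U" S] U S unfolding un by simp
  moreover have "arcs (S - U) S = arcs (S - U) U + arcs (S - U) (S - U)"
    using arcs_Un_right[of U "S - U" "S - U"] U S unfolding un by simp
  moreover have "arcs (S - U) U \<le> arcs U S"
    by (subst arcs_commute, rule arcs_mono) (use U S in auto)
  ultimately have "0 < arcs (S - U) (S - U)" using assms(3) US by linarith
  then obtain a b where ab: "a \<in> S - U" "b \<in> S - U" "adj a b"
    unfolding arcs_def by (auto simp: card_gt_0_iff)
  hence "a \<noteq> b" by auto
  have nin: "a \<notin> \<alpha> ` {..<k}" "a \<notin> \<beta> ` {..<k}" "b \<notin> \<alpha> ` {..<k}" "b \<notin> \<beta> ` {..<k}"
    using ab by (auto simp: U_def)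
  have img: "(\<alpha>(k := a)) ` {..<Suc k} = insert a (\<alpha> ` {..<k})"
    "(\<beta>(k := b)) ` {..<Suc k} = insert b (\<beta> ` {..<k})"
    unfolding lessThan_Suc by auto
  show ?case
  proof (rule exI[of _ "\<alpha>(k := a)"], rule exI[of _ "\<beta>(k := b)"], intro conjI allI impI)
    show "inj_on (\<alpha>(k := a)) {..<Suc k}" "inj_on (\<beta>(k := b)) {..<Suc k}"
      using \<alpha>\<beta>(1,2) nin unfolding lessThan_Suc by (simp_all add: inj_on_fun_updI)
    show "adj ((\<alpha>(k := a)) i) ((\<beta>(k := b)) i)" if "i < Suc k" for i
      using that \<alpha>\<beta>(6) ab(3) by (auto simp: less_Suc_eq)
  qed (use img \<alpha>\<beta>(3-5) nin ab(1,2) \<open>a \<noteq> b\<close> in auto)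
qed

lemma inner_arcs_le:
  assumes ls: "\<forall>t\<in>set ls. odd t \<and> 3 \<le> t" and ST: "S \<subseteq> V" "T \<subseteq> V" "S \<inter> T = {}"
    and "\<And>v. v \<in> S \<Longrightarrow> card (T - nb v) \<le> D" and "\<And>v. v \<in> T \<Longrightarrow> card (S - nb v) \<le> D"
    and deg: "\<And>v. v \<in> S \<Longrightarrow> card (nb v \<inter> S) \<le> D"
    and M: "M = length ls * sum_list ls"
    and "M + 1 + 2 * length ls * D \<le> card T" "M + 2 * length ls + (M + 1) * D \<le> card S"
    and no: "\<not> embeds (cycle_bouquet ls) G"
  shows "arcs S S \<le> 4 * length ls * D"
proof (rule ccontr)
  assume "\<not> ?thesis"
  hence "4 * length ls * D < arcs S S" by simp
  moreover have "finite S" using ST(1) by (rule finite_subset) simp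
  ultimately obtain \<alpha> \<beta> where "inj_on \<alpha> {..<length ls}" "inj_on \<beta> {..<length ls}"
    "\<alpha> ` {..<length ls} \<subseteq> S" "\<beta> ` {..<length ls} \<subseteq> S"
    "\<alpha> ` {..<length ls} \<inter> \<beta> ` {..<length ls} = {}" "\<forall>i<length ls. adj (\<alpha> i) (\<beta> i)"
    using arcs_imp_matching[of S D "length ls" "length ls"] deg by blast
  hence "embeds (cycle_bouquet ls) G"
    using matching_imp_embeds[OF ls ST assms(5,6) M assms(9,10)] by blast
  thus False using no by simp
qed

end

section \<open>The adjacency operator\<close>

locale nat_graph = fin_graph G for G :: "nat graph" +
  fixes n :: nat
  assumes V: "vertices G = {..<n}" and n: "0 < n"
begin

abbreviation "lam \<equiv> spectral_radius (adjacency_matrix n G)"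

abbreviation "wt i j \<equiv> (of_bool (adj i j) :: real)"

lemma adjacency_matrix_eq: "adjacency_matrix n G = complex_mat n (\<lambda>i j. wt i j)"
  by (rule eq_matI) (auto simp: adjacency_matrix_def complex_mat_def adj_def)

lemma real_apply_wt: "real_apply n (\<lambda>i j. wt i j) u i = (\<Sum>j\<in>nb i. u j)"
proof -
  have "(\<Sum>j<n. wt i j * u j) = (\<Sum>j\<in>nb i. wt i j * u j)"
    using nb_subset V by (intro sum.mono_neutral_right) auto
  thus ?thesis by (simp add: real_apply_def)
qed

lemma lam_nonneg: "0 \<le> lam"
  unfolding adjacency_matrix_eq using n by (intro spectral_radius_nonneg) auto

lemma norm_sq_le: "(\<Sum>i<n. (\<Sum>j\<in>nb i. u j)\<^sup>2) \<le> lam\<^sup>2 * (\<Sum>i<n. (u i)\<^sup>2)"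
  using symmetric_norm_le_spectral_radius[of n "\<lambda>i j. wt i j" u] n
  by (simp add: real_apply_wt adjacency_matrix_eq adj_sym)

text \<open>The Rayleigh bound, by Cauchy-Schwarz from the norm bound
  \<open>norm_sq_le\<close>.\<close>

lemma quadratic_form_le: "(\<Sum>i<n. u i * (\<Sum>j\<in>nb i. u j)) \<le> lam * (\<Sum>i<n. (u i)\<^sup>2)" (is "?L \<le> ?R")
proof -
  have "?L\<^sup>2 \<le> (\<Sum>i<n. (u i)\<^sup>2) * (\<Sum>i<n. (\<Sum>j\<in>nb i. u j)\<^sup>2)"
    by (rule Cauchy_Schwarz_ineq_sum)
  also have "\<dots> \<le> (\<Sum>i<n. (u i)\<^sup>2) * (lam\<^sup>2 * (\<Sum>i<n. (u i)\<^sup>2))"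
    using norm_sq_le by (intro mult_left_mono) (auto intro: sum_nonneg)
  also have "\<dots> = ?R\<^sup>2" by (simp add: power2_eq_square)
  finally have "?L\<^sup>2 \<le> ?R\<^sup>2" .
  moreover have "0 \<le> ?R" using lam_nonneg by (simp add: sum_nonneg)
  ultimately show ?thesis by (rule power2_le_imp_le)
qed

lemma eigenvector:
  obtains x v where "\<And>i. i < n \<Longrightarrow> 0 \<le> x i \<and> x i \<le> 1" "v < n" "x v = (1::real)"
    "\<And>i. i < n \<Longrightarrow> (\<Sum>j\<in>nb i. x j) = lam * x i"
  using nonneg_symmetric_eigenvector[of n "\<lambda>i j. wt i j"] n
  by (auto simp: real_apply_wt adjacency_matrix_eq adj_sym)

text \<open>Test vector \<open>1\<close>. Since degrees are integers, \<open>d\<^sup>2 \<ge> n d - \<lfloor>n\<^sup>2/4\<rfloor>\<close>, which for odd \<open>n\<close> is better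
  than what the average degree gives.\<close>

lemma lam_sq_ge: "2 * real (card (edges G)) - real (n\<^sup>2 div 4) \<le> lam\<^sup>2"
proof -
  have "n * d \<le> d\<^sup>2 + n\<^sup>2 div 4" if "d \<le> n" for d
  proof -
    have "0 \<le> (int n - 2 * int d)\<^sup>2" by simp
    hence "int (4 * n * d) \<le> int (4 * d\<^sup>2 + n\<^sup>2)" by (simp add: power2_eq_square algebra_simps)
    hence "4 * (n * d) \<le> 4 * d\<^sup>2 + n\<^sup>2" unfolding of_nat_le_iff by simp
    thus ?thesis by linarith
  qed
  moreover have "card (nb i) \<le> n" for i using card_mono[OF finite_V nb_subset] V by simp
  ultimately have "(\<Sum>i<n. n * card (nb i)) \<le> (\<Sum>i<n. (card (nb i))\<^sup>2 + n\<^sup>2 div 4)"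
    by (intro sum_mono) auto
  moreover have "(\<Sum>i<n. card (nb i)) = 2 * card (edges G)"
  proof -
    have "nb i \<inter> V = nb i" for i using nb_subset by auto
    thus ?thesis using arcs_eq_sum[OF finite_V, of V] arcs_VV V by simp
  qed
  ultimately have "n * (2 * card (edges G)) \<le> (\<Sum>i<n. (card (nb i))\<^sup>2) + n * (n\<^sup>2 div 4)"
    by (simp add: sum.distrib flip: sum_distrib_left)
  hence "real (n * (2 * card (edges G))) \<le> real ((\<Sum>i<n. (card (nb i))\<^sup>2) + n * (n\<^sup>2 div 4))"
    unfolding of_nat_le_iff .
  moreover have "real (\<Sum>i<n. (card (nb i))\<^sup>2) \<le> lam\<^sup>2 * real n"
    using norm_sq_le[of "\<lambda>_. 1"] by simp
  ultimately have "real n * (2 * real (card (edges G)) - real (n\<^sup>2 div 4)) \<le> real n * lam\<^sup>2"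
    by (simp add: algebra_simps)
  thus ?thesis using n by simp
qed

text \<open>The quadratic form of the new graph at \<open>x(v := t)\<close> is
  \<open>\<lambda> (\<Sum>x\<^sup>2 - 2 x\<^sub>v\<^sup>2) + 2 t \<Sum>\<^sub>W x\<close>; the choice \<open>t = x\<^sub>v\<close> gives the claim, except when \<open>x\<^sub>v = 0\<close>.\<close>

lemma relink_weight:
  assumes v: "v < n" and W: "W \<subseteq> V - {v}"
    and x: "\<And>i. i < n \<Longrightarrow> 0 \<le> x i" "\<And>i. i < n \<Longrightarrow> (\<Sum>j\<in>nb i. x j) = lam * x i"
    and le: "spectral_radius (adjacency_matrix n (relink {v} W)) \<le> lam"
  shows "(\<Sum>w\<in>W. x w) \<le> lam * x v"
proof -
  interpret G': nat_graph "relink {v} W" n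
  proof
    show "simple_graph (relink {v} W)" using v W V by (intro simple_relink) auto
    show "vertices (relink {v} W) = {..<n}" using V by (simp add: relink_def)
  qed (rule n)
  define \<sigma> where "\<sigma> = (\<Sum>w\<in>W. x w)"
  define R where "R = {..<n} - {v}"
  have finW: "finite W" using W by (rule finite_subset) simp
  have WR: "W \<subseteq> R" using W V by (auto simp: R_def)
  have finR: "finite R" by (simp add: R_def)
  have split: "(\<Sum>i<n. h i) = h v + (\<Sum>i\<in>R. h i)" for h :: "nat \<Rightarrow> real"
    unfolding R_def using v by (subst sum.remove[of _ v]) auto
  have \<sigma>0: "\<sigma> \<ge> 0" unfolding \<sigma>_def using x(1) WR by (intro sum_nonneg) (auto simp: R_def)
  have nb_v: "G'.nb v = W"
    using W by (auto simp: G'.nb_def G'.adj_def edge_relink_iff)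
  have nb_i: "G'.nb i = (nb i - {v}) \<union> (if i \<in> W then {v} else {})" if "i \<in> R" for i
    using that W by (auto simp: G'.nb_def G'.adj_def edge_relink_iff R_def split: if_splits)
  \<comment> \<open>The value \<open>t\<close> at \<open>v\<close> stays free because the case
    \<open>x v = 0\<close> needs a choice other than \<open>t = x v\<close>.\<close>
  have key: "2 * t * \<sigma> \<le> lam * ((x v)\<^sup>2 + t\<^sup>2)" for t
  proof -
    let ?u = "x(v := t)"
    have uv: "?u v * (\<Sum>j\<in>G'.nb v. ?u j) = t * \<sigma>"
      unfolding nb_v \<sigma>_def using W by (auto intro!: sum.cong)
    have ui: "?u i * (\<Sum>j\<in>G'.nb i. ?u j) =
        lam * (x i)\<^sup>2 - x v * (if i \<in> nb v then x i else 0) + t * (if i \<in> W then x i else 0)" if i: "i \<in> R" for i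
    proof -
      have "(\<Sum>j\<in>G'.nb i. ?u j) = (\<Sum>j\<in>nb i - {v}. ?u j) + (if i \<in> W then t else 0)"
        unfolding nb_i[OF i] by (subst sum.union_disjoint) auto
      also have "(\<Sum>j\<in>nb i - {v}. ?u j) = (\<Sum>j\<in>nb i - {v}. x j)" by (intro sum.cong) auto
      also have "\<dots> = (\<Sum>j\<in>nb i. x j) - (if v \<in> nb i then x v else 0)" by (simp add: sum_diff1)
      also have "(\<Sum>j\<in>nb i. x j) = lam * x i" using x(2) i by (auto simp: R_def)
      finally have sum_eq: "(\<Sum>j\<in>G'.nb i. ?u j) =
          lam * x i - (if v \<in> nb i then x v else 0) + (if i \<in> W then t else 0)" .
      have "?u i = x i" "v \<in> nb i \<longleftrightarrow> i \<in> nb v" using i adj_sym by (auto simp: R_def)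
      thus ?thesis unfolding sum_eq
        by (cases "i \<in> nb v"; cases "i \<in> W") (simp_all add: algebra_simps power2_eq_square)
    qed
    have "(\<Sum>i\<in>R. if i \<in> nb v then x i else 0) = (\<Sum>i\<in>nb v. x i)"
    proof -
      have "nb v \<subseteq> R" using nb_subset V by (auto simp: R_def)
      thus ?thesis using sum.inter_restrict[OF finR, of x "nb v"] by (simp add: inf_absorb2)
    qed
    hence nbv: "(\<Sum>i\<in>R. if i \<in> nb v then x i else 0) = lam * x v" using x(2)[OF v] by simp
    have Wsum: "(\<Sum>i\<in>R. if i \<in> W then x i else 0) = \<sigma>"
      unfolding \<sigma>_def using sum.inter_restrict[OF finR, of x W] WR by (simp add: inf_absorb2)
    have "(\<Sum>i<n. ?u i * (\<Sum>j\<in>G'.nb i. ?u j)) = t * \<sigma> +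
        (\<Sum>i\<in>R. lam * (x i)\<^sup>2 - x v * (if i \<in> nb v then x i else 0) + t * (if i \<in> W then x i else 0))"
      unfolding split uv using ui by (intro arg_cong2[where f = "(+)"] refl sum.cong)
    also have "\<dots> = t * \<sigma> + (lam * (\<Sum>i\<in>R. (x i)\<^sup>2) - x v * (lam * x v) + t * \<sigma>)"
      unfolding nbv[symmetric] Wsum[symmetric]
      by (simp add: sum.distrib sum_subtractf sum_distrib_left)
    finally have "2 * t * \<sigma> + lam * (\<Sum>i\<in>R. (x i)\<^sup>2) - lam * (x v)\<^sup>2 =
        (\<Sum>i<n. ?u i * (\<Sum>j\<in>G'.nb i. ?u j))" by (simp add: algebra_simps power2_eq_square)
    also have "\<dots> \<le> G'.lam * (\<Sum>i<n. (?u i)\<^sup>2)" by (rule G'.quadratic_form_le)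
    also have "\<dots> \<le> lam * (\<Sum>i<n. (?u i)\<^sup>2)" using le by (intro mult_right_mono) (auto intro: sum_nonneg)
    also have "(\<Sum>i<n. (?u i)\<^sup>2) = t\<^sup>2 + (\<Sum>i\<in>R. (x i)\<^sup>2)"
      unfolding split by (auto simp: R_def intro!: sum.cong)
    finally show ?thesis by (simp add: algebra_simps)
  qed
  have "\<sigma> \<le> lam * x v"
  proof (cases "x v = 0")
    case True
    \<comment> \<open>For \<open>lam > 0\<close> the choice \<open>t = \<sigma> / lam\<close>
      balances both sides of \<open>key\<close> to
      \<open>2 * \<sigma> * \<sigma> \<le> \<sigma> * \<sigma>\<close>; for \<open>lam = 0\<close>
      any positive \<open>t\<close> serves.\<close>
    have "\<sigma> \<le> 0"
    proof (cases "lam = 0")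
      case True
      thus ?thesis using key[of 1] by simp
    next
      case False
      hence "2 * \<sigma> * \<sigma> \<le> \<sigma> * \<sigma>"
        using key[of "\<sigma> / lam"] \<open>x v = 0\<close> lam_nonneg by (simp add: field_simps power2_eq_square)
      hence "\<sigma> * \<sigma> \<le> 0" by simp
      thus ?thesis using mult_pos_pos[of \<sigma> \<sigma>] by linarith
    qed
    thus ?thesis using True by simp
  next
    case False
    hence "0 < x v" using x(1)[OF v] by simp
    moreover have "x v * \<sigma> \<le> x v * (lam * x v)" using key[of "x v"] by (simp add: power2_eq_square algebra_simps)
    ultimately show ?thesis by simp
  qed
  thus ?thesis by (simp add: \<sigma>_def)
qed

end

section \<open>The balanced complete bipartite graph, the competitor behind the lower bound on
  \<open>lam\<close>\<close>

lemma card_complete_bipartite_edges: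
  assumes "finite X" "finite Y" "X \<inter> Y = {}"
  shows "card {{u, w} | u w. u \<in> X \<and> w \<in> Y} = card X * card Y"
proof -
  have "{{u, w} | u w. u \<in> X \<and> w \<in> Y} = (\<lambda>(u, w). {u, w}) ` (X \<times> Y)" by auto
  moreover have "inj_on (\<lambda>(u, w). {u, w}) (X \<times> Y)"
    using assms(3) by (auto simp: inj_on_def doubleton_eq_iff)
  ultimately show ?thesis by (simp add: card_image card_cartesian_product)
qed

definition turan_graph :: "nat \<Rightarrow> nat graph" where
  "turan_graph n = ({..<n}, {{u, w} | u w. u \<in> {..<n div 2} \<and> w \<in> {n div 2..<n}})"

lemma simple_turan_graph: "simple_graph (turan_graph n)"
proof -
  have "card {u, w} = 2" if "u < n div 2" "n div 2 \<le> w" for u w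
  proof -
    have "u \<noteq> w" using that by simp
    thus ?thesis by simp
  qed
  thus ?thesis by (auto simp: simple_graph_def turan_graph_def)
qed

lemma half_mult_half: "n div 2 * (n - n div 2) = n\<^sup>2 div 4" for n :: nat
proof (cases "even n")
  case True
  then obtain k where "n = 2 * k" by auto
  thus ?thesis by (simp add: power2_eq_square)
next
  case False
  then obtain k where k: "n = 2 * k + 1" by (auto elim: oddE)
  hence "n\<^sup>2 = 4 * (k * (k + 1)) + 1" by (simp add: power2_eq_square)
  thus ?thesis using k by simp
qed

lemma card_edges_turan_graph: "card (edges (turan_graph n)) = n\<^sup>2 div 4"
  unfolding turan_graph_def snd_conv half_mult_half[symmetric]
  by (subst card_complete_bipartite_edges) auto

lemma turan_graph_free:
  assumes ls: "\<forall>t\<in>set ls. odd t \<and> 3 \<le> t" and "ls \<noteq> []"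
  shows "\<not> embeds (cycle_bouquet ls) (turan_graph n)"
proof
  assume emb: "embeds (cycle_bouquet ls) (turan_graph n)"
  have ls3: "\<forall>t\<in>set ls. 3 \<le> t" using ls by auto
  obtain f where f: "\<forall>e\<in>edges (cycle_bouquet ls). f ` e \<in> edges (turan_graph n)"
    using emb unfolding embeds_def by auto
  let ?l = "ls ! 0"
  have l: "odd ?l" "3 \<le> ?l" using ls assms(2) by (auto simp: hd_conv_nth[symmetric])
  define P where "P v \<longleftrightarrow> f v < n div 2" for v
  have P: "P u \<noteq> P w" if "{u, w} \<in> edges (cycle_bouquet ls)" for u w
    using f that unfolding turan_graph_def P_def by (fastforce simp: doubleton_eq_iff)
  have e: "{(0, 0), (0, 1)} \<in> edges (cycle_bouquet ls)"
    "{(0, ?l - 1), (0, 0)} \<in> edges (cycle_bouquet ls)"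
    "\<And>j. 1 \<le> j \<Longrightarrow> Suc j < ?l \<Longrightarrow> {(0, j), (0, Suc j)} \<in> edges (cycle_bouquet ls)"
    using assms(2) unfolding edges_cycle_bouquet[OF ls3] by (auto intro!: bexI[of _ 0])
  \<comment> \<open>Along the first cycle the sides alternate, so the last position, which is even,
    falls on the side of the centre, its neighbour.\<close>
  have "j < ?l \<Longrightarrow> P (0, j) = (P (0, 0) = even j)" for j
  proof (induction j)
    case (Suc j)
    thus ?case using P[OF e(1)] P[OF e(3), of j] by (cases "j = 0") auto
  qed simp
  from this[of "?l - 1"] show False using P[OF e(2)] l by auto
qed

section \<open>Structure of spectrally extremal graphs\<close>

context fin_graph
begin

text \<open>For disjoint sets this is the number of missing cross edges, each counted once.\<close>

definition miss :: "'a set \<Rightarrow> 'a set \<Rightarrow> nat" where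
  "miss X Y = (\<Sum>u\<in>X. card (Y - nb u))"

lemma miss_plus_arcs:
  assumes "finite X" "finite Y"
  shows "miss X Y + arcs X Y = card X * card Y"
proof -
  have "card (Y - nb u) + card (nb u \<inter> Y) = card Y" for u
    using card_Diff_subset_Int[of Y "nb u"] card_mono[of Y "nb u \<inter> Y"] assms(2)
    by (simp add: Int_commute)
  hence "(\<Sum>u\<in>X. card (Y - nb u) + card (nb u \<inter> Y)) = card X * card Y" by simp
  thus ?thesis using assms by (simp add: miss_def arcs_eq_sum sum.distrib)
qed

lemma miss_commute:
  assumes "finite X" "finite Y"
  shows "miss X Y = miss Y X"
  using miss_plus_arcs[OF assms] miss_plus_arcs[OF assms(2,1)] arcs_commute[of X Y]
  by (simp add: mult.commute)

lemma miss_mono: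
  assumes "finite X'" "finite Y'" "X \<subseteq> X'" "Y \<subseteq> Y'"
  shows "miss X Y \<le> miss X' Y'"
proof -
  have "miss X Y \<le> (\<Sum>u\<in>X. card (Y' - nb u))"
    unfolding miss_def using assms by (intro sum_mono card_mono) auto
  also have "\<dots> \<le> miss X' Y'" unfolding miss_def using assms by (intro sum_mono2) auto
  finally show ?thesis .
qed

text \<open>The factor \<open>k\<close> lets fractional lower bounds such as \<open>n / 5\<close> be
  stated in natural numbers.\<close>

lemma card_mult_le_miss:
  assumes "\<And>u. u \<in> X \<Longrightarrow> c \<le> k * card (Y - nb u)"
  shows "card X * c \<le> k * miss X Y"
  using sum_bounded_below[of X c "\<lambda>u. k * card (Y - nb u)"] assms
  by (simp add: miss_def sum_distrib_left)

end

lemma mult_le_quarter_square: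
  fixes a b n :: nat
  assumes "a + b = n"
  shows "a * b \<le> n\<^sup>2 div 4"
proof -
  have "0 \<le> (int a - int b)\<^sup>2" by simp
  hence "int (4 * (a * b)) \<le> int (n\<^sup>2)"
    using assms by (auto simp: power2_eq_square algebra_simps)
  hence "4 * (a * b) \<le> n\<^sup>2" unfolding of_nat_le_iff .
  thus ?thesis by linarith
qed

lemma less_four_times_div: "k div 4 \<le> m \<Longrightarrow> k < 4 * m + 4" for k m :: nat
  by linarith

text \<open>If \<open>a < n / 4\<close>, the product is below \<open>3/16\<close> of the square of
  \<open>n\<close>. The gap to a quarter exceeds \<open>2 * N * n\<close>, at most
  \<open>1/500\<close> of that square, plus the rounding error.\<close>

lemma quarter_le_of_product:
  fixes a b n N :: nat
  assumes "a + b = n" "n\<^sup>2 div 4 \<le> 2 * N * n + a * b" "1000 * N \<le> n" "0 < N"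
  shows "n \<le> 4 * a"
proof (rule ccontr)
  assume "\<not> ?thesis"
  hence a: "real a < real n / 4" by simp
  have b: "real b = real n - real a" using assms(1) by simp
  have "0 < (real n / 4 - real a) * (3 * real n / 4 - real a)" using a by (intro mult_pos_pos) auto
  hence "real a * real b < 3 * (real n)\<^sup>2 / 16" by (simp add: b power2_eq_square field_simps)
  moreover have "real (2 * N * n) \<le> (real n)\<^sup>2 / 500"
  proof -
    have "real (1000 * N) * real n \<le> real n * real n" using assms(3) by (intro mult_right_mono) auto
    thus ?thesis by (simp add: power2_eq_square)
  qed
  moreover have "real (n\<^sup>2) < real (4 * (2 * N * n + a * b) + 4)"
    unfolding of_nat_less_iff using assms(2) by (rule less_four_times_div)
  moreover have "1000 * 1000 \<le> (real n)\<^sup>2"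
  proof -
    have "1000 \<le> n" using assms(3,4) by linarith
    hence "1000 * 1000 \<le> real n * real n" by (intro mult_mono) auto
    thus ?thesis by (simp add: power2_eq_square)
  qed
  ultimately show False by simp
qed

text \<open>\<open>N\<close> is the number of path vertices that forces a bouquet, and bounds the
  order of the bouquet. The factor 86 arises as \<open>36 + 50\<close> from the error
  \<open>36 * N\<^sup>2 + 50 * N\<close> in \<open>near_bipartition_exists\<close>, and
  \<open>D ^ 4\<close> is the size that \<open>excess_less\<close> requires with
  \<open>Q = D ^ 3 / 86\<close>.\<close>

locale extremal = nat_graph G n for G n +
  fixes ls :: "nat list" and N D :: nat and x :: "nat \<Rightarrow> real" and vm :: nat
  assumes ls: "\<forall>t\<in>set ls. odd t \<and> 3 \<le> t" and ls_ne: "ls \<noteq> []"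
    and N: "N = length ls * sum_list ls + 1" and D: "D = 86 * N\<^sup>2"
    and large: "D ^ 4 \<le> n"
    and no_embed: "\<not> embeds (cycle_bouquet ls) G"
    and lam_max: "\<And>G'. simple_graph G' \<Longrightarrow> vertices G' = {..<n} \<Longrightarrow> \<not> embeds (cycle_bouquet ls) G' \<Longrightarrow>
      spectral_radius (adjacency_matrix n G') \<le> lam"
    and x: "\<And>i. i < n \<Longrightarrow> 0 \<le> x i" "\<And>i. i < n \<Longrightarrow> x i \<le> 1"
    and vm: "vm < n" "x vm = 1"
    and eig: "\<And>i. i < n \<Longrightarrow> (\<Sum>j\<in>nb i. x j) = lam * x i"
begin

lemma ls3: "\<forall>t\<in>set ls. 3 \<le> t" using ls by auto

lemma sum_list_ge: "3 \<le> sum_list ls"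
proof -
  have "3 \<le> ls ! 0" using ls ls_ne by auto
  also have "\<dots> \<le> sum_list ls" using ls_ne by (intro elem_le_sum_list) auto
  finally show ?thesis .
qed

lemma N_ge: "4 \<le> N"
  unfolding N using mult_le_mono[of 1 "length ls" 3 "sum_list ls"] sum_list_ge ls_ne
  by (simp add: Suc_leI)

lemma length_le: "length ls \<le> N"
proof -
  have "length ls * 1 \<le> length ls * sum_list ls" using sum_list_ge by (intro mult_le_mono) auto
  thus ?thesis unfolding N by linarith
qed

lemma card_bouquet_le: "card (vertices (cycle_bouquet ls)) \<le> N"
proof -
  have "vertices (cycle_bouquet ls) \<subseteq> insert (0, 0) ({..<length ls} \<times> {1..sum_list ls})"
  proof -
    have "j \<le> sum_list ls" if "i < length ls" "j < ls ! i" for i j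
      using elem_le_sum_list[OF that(1)] that(2) by linarith
    thus ?thesis unfolding vertices_cycle_bouquet[OF ls3] by auto
  qed
  hence "card (vertices (cycle_bouquet ls)) \<le> card (insert (0, 0) ({..<length ls} \<times> {1..sum_list ls}))"
    by (intro card_mono) auto
  also have "\<dots> \<le> N" unfolding N by (simp add: card_insert_if)
  finally show ?thesis .
qed

lemma N_le_N_sq: "4 * N \<le> N\<^sup>2" using N_ge by (simp add: power2_eq_square)

lemma D_ge: "1376 \<le> D" using N_le_N_sq N_ge unfolding D by simp

lemma n_ge: "1000 * N\<^sup>2 \<le> n" "1000 * N \<le> n" "D * D\<^sup>2 * 1376 \<le> n"
proof -
  have "D * D\<^sup>2 * 1376 \<le> D * D\<^sup>2 * D" using D_ge by (intro mult_left_mono) auto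
  also have "\<dots> = D ^ 4" by (simp add: power2_eq_square numeral_eq_Suc)
  finally show *: "D * D\<^sup>2 * 1376 \<le> n" using large by simp
  have "D * 1 \<le> D * D\<^sup>2" using D_ge by (intro mult_left_mono) auto
  hence "D * 1376 \<le> n" using * by linarith
  thus "1000 * N\<^sup>2 \<le> n" unfolding D by linarith
  thus "1000 * N \<le> n" using N_le_N_sq by linarith
qed

lemma card_V: "card V = n" using V by simp

lemma quarter_le_lam_sq: "real (n\<^sup>2 div 4) \<le> lam\<^sup>2"
proof -
  interpret T: nat_graph "turan_graph n" n
  proof
    show "vertices (turan_graph n) = {..<n}" by (simp add: turan_graph_def)
  qed (rule simple_turan_graph n)+
  have "real (n\<^sup>2 div 4) \<le> T.lam\<^sup>2" using T.lam_sq_ge by (simp add: card_edges_turan_graph)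
  also have "\<dots> \<le> lam\<^sup>2"
  proof (rule power_mono[OF _ T.lam_nonneg])
    show "T.lam \<le> lam"
      using lam_max[OF T.simple T.V turan_graph_free[OF ls ls_ne]] .
  qed
  finally show ?thesis .
qed

lemma lam_lower: "(real n - 1) / 2 \<le> lam"
proof (rule power2_le_imp_le[OF _ lam_nonneg])
  have "real (n\<^sup>2) < real (4 * (n\<^sup>2 div 4) + 4)"
    unfolding of_nat_less_iff by (rule less_four_times_div) simp
  moreover have "1000 \<le> n" using n_ge(2) N_ge by linarith
  ultimately have "((real n - 1) / 2)\<^sup>2 \<le> real (n\<^sup>2 div 4)"
    by (simp add: power_divide power2_diff)
  thus "((real n - 1) / 2)\<^sup>2 \<le> lam\<^sup>2" using quarter_le_lam_sq by linarith
qed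

lemma sum_x_le_card:
  assumes "X \<subseteq> V"
  shows "(\<Sum>i\<in>X. x i) \<le> real (card X)"
  using sum_bounded_above[of X x 1] x(2) assms V by auto

section \<open>First approximation to the bipartition: the neighbourhood of a heaviest vertex and
  its complement\<close>

definition "B = nb vm"
definition "A = V - nb vm"

lemma AB: "A \<union> B = V" "A \<inter> B = {}" "finite A" "finite B" "A \<subseteq> V" "B \<subseteq> V"
  using nb_subset by (auto simp: A_def B_def)

lemma card_AB: "card A + card B = n"
  using card_Un_disjoint[of A B] AB card_V by simp

text \<open>As \<open>x vm = 1\<close>, the weights on \<open>B\<close> sum to \<open>lam\<close>.
  Applying the eigenvalue equation again bounds \<open>lam\<^sup>2\<close> by the arcs leaving
  vertices of \<open>B\<close>, of which at most \<open>2 * N * n\<close> stay inside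
  \<open>B\<close>.\<close>

lemma quarter_le_arcs: "n\<^sup>2 div 4 \<le> 2 * N * n + arcs A B"
proof -
  have sum_B: "(\<Sum>u\<in>B. x u) = lam" using eig[OF vm(1)] vm(2) by (simp add: B_def)
  have "lam\<^sup>2 = (\<Sum>u\<in>B. lam * x u)"
    by (simp add: sum_B power2_eq_square flip: sum_distrib_left)
  also have "\<dots> = (\<Sum>u\<in>B. \<Sum>w\<in>nb u. x w)"
    using AB V by (intro sum.cong refl eig[symmetric]) auto
  also have "\<dots> \<le> (\<Sum>u\<in>B. real (card (nb u)))"
    using nb_subset by (intro sum_mono sum_x_le_card) auto
  also have "\<dots> = real (arcs B V)"
  proof -
    have "nb u \<inter> V = nb u" for u using nb_subset by auto
    thus ?thesis using AB by (simp add: arcs_eq_sum)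
  qed
  finally have "real (n\<^sup>2 div 4) \<le> real (arcs B V)" using quarter_le_lam_sq by linarith
  hence "n\<^sup>2 div 4 \<le> arcs B V" unfolding of_nat_le_iff .
  also have "arcs B V = arcs B A + arcs B B" using arcs_Un_right[of A B B] AB by simp
  also have "arcs B B \<le> 2 * N * card B"
    using nb_arcs_le[OF ls3 no_embed, of vm] vm V by (simp add: B_def N)
  also have "2 * N * card B \<le> 2 * N * n" using card_AB by (intro mult_left_mono) auto
  finally show ?thesis by (simp add: arcs_commute)
qed

lemma miss_AB: "miss A B \<le> 2 * N * n"
  using miss_plus_arcs[of A B] AB quarter_le_arcs mult_le_quarter_square[OF card_AB] by linarith

lemma card_A_B_ge: "n \<le> 4 * card A" "n \<le> 4 * card B"
proof -
  have "arcs A B \<le> card A * card B" using miss_plus_arcs[of A B] AB by linarith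
  hence *: "n\<^sup>2 div 4 \<le> 2 * N * n + card A * card B" using quarter_le_arcs by linarith
  show "n \<le> 4 * card A"
    using quarter_le_of_product[OF card_AB * n_ge(2)] N_ge by simp
  show "n \<le> 4 * card B"
    using quarter_le_of_product[of "card B" "card A" n N] card_AB * n_ge(2) N_ge by (simp add: ac_simps)
qed

text \<open>A copy of the bouquet uses at most \<open>N\<close> vertices of \<open>W\<close>, each
  missing at most \<open>d\<close> vertices of \<open>U\<close>, which leaves \<open>N\<close>
  common neighbours; the \<open>+ 1\<close> pays for \<open>v\<close>, which may lie in
  \<open>U\<close>.\<close>

lemma relink_bound:
  assumes v: "v < n" and W: "W \<subseteq> V - {v}" and U: "U \<subseteq> V"
    and d: "\<And>w. w \<in> W \<Longrightarrow> card (U - nb w) \<le> d" and big: "N * d + N + 1 \<le> card U"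
  shows "(\<Sum>w\<in>W. x w) \<le> lam * x v"
proof (rule relink_weight[OF v W x(1) eig])
  have vV: "v \<in> V" using v V by simp
  have "finite U" using U by (rule finite_subset) simp
  have "\<not> embeds (cycle_bouquet ls) (relink {v} W)"
  proof
    assume emb: "embeds (cycle_bouquet ls) (relink {v} W)"
    have "embeds (cycle_bouquet ls) G"
    proof (rule embeds_relink[OF simple_graph_cycle_bouquet[OF ls3] _ _ emb])
      show "{v} \<inter> W = {}" using W by auto
      fix X assume X: "X \<subseteq> W" "finite X" "card X \<le> card (vertices (cycle_bouquet ls))"
      have "card (U - {v} - nb w) \<le> d" if "w \<in> X" for w
        using d[of w] that X(1) card_mono[of "U - nb w" "U - {v} - nb w"] \<open>finite U\<close> by fastforce
      hence "card (U - {v}) \<le> card {u \<in> U - {v}. \<forall>w\<in>X. adj u w} + card X * d"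
        using X(2) \<open>finite U\<close> by (intro card_common_nb) auto
      moreover have "card X * d \<le> N * d" using X(3) card_bouquet_le by (intro mult_right_mono) auto
      moreover have "card U - 1 \<le> card (U - {v})" using diff_card_le_card_Diff[of "{v}" U] by simp
      moreover have "card {u \<in> U - {v}. \<forall>w\<in>X. adj u w} \<le> card {u \<in> V - {v}. \<forall>w\<in>X. adj u w}"
        using U by (intro card_mono) auto
      ultimately show "card (vertices (cycle_bouquet ls)) \<le> card {u \<in> V - {v}. \<forall>w\<in>X. adj u w}"
        using big card_bouquet_le by linarith
    qed
    thus False using no_embed by simp
  qed
  moreover have "simple_graph (relink {v} W)" using W vV by (intro simple_relink) auto
  moreover have "vertices (relink {v} W) = {..<n}" using V by (simp add: relink_def)
  ultimately show "spectral_radius (adjacency_matrix n (relink {v} W)) \<le> lam" using lam_max by blast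
qed

text \<open>Reattaching \<open>v\<close> to the vertices of \<open>B\<close> that see most of
  \<open>A\<close> gains nothing, so \<open>lam * x v\<close> is at least their weight, which is
  \<open>lam\<close> up to the few vertices left out.\<close>

lemma x_lower:
  assumes v: "v < n"
  shows "lam - 17 * real (N\<^sup>2) \<le> lam * x v"
proof -
  \<comment> \<open>Then \<open>N * d\<close> is at most half of \<open>card A\<close>, as
    \<open>relink_bound\<close> needs, while every vertex outside \<open>B'\<close> misses more than
    \<open>card A / (2 * N)\<close> vertices, which \<open>miss_AB\<close> allows for at most
    \<open>16 * N\<^sup>2\<close> of them.\<close>
  define d where "d = card A div (2 * N)"
  define B' where "B' = {w \<in> B. card (A - nb w) \<le> d}"
  have B': "B' \<subseteq> B" by (auto simp: B'_def)
  have "card (B - B') * card A \<le> 2 * N * miss (B - B') A"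
  proof (rule card_mult_le_miss)
    fix u assume "u \<in> B - B'"
    hence "d + 1 \<le> card (A - nb u)" by (auto simp: B'_def)
    hence "2 * N * (d + 1) \<le> 2 * N * card (A - nb u)" by (intro mult_left_mono) auto
    moreover have "card A < 2 * N * (d + 1)"
      unfolding d_def using N_ge dividend_less_times_div[of "2 * N" "card A"] by simp
    ultimately show "card A \<le> 2 * N * card (A - nb u)" by linarith
  qed
  also have "miss (B - B') A \<le> miss B A" using AB by (intro miss_mono) auto
  also have "miss B A \<le> 2 * N * n" using miss_AB miss_commute AB by metis
  finally have "card (B - B') * card A \<le> 2 * N * (2 * N * n)" by simp
  hence "4 * (card (B - B') * card A) \<le> (16 * N\<^sup>2) * n"
    by (simp add: power2_eq_square algebra_simps)
  moreover have "card (B - B') * n \<le> card (B - B') * (4 * card A)"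
    using card_A_B_ge(1) by (intro mult_left_mono) auto
  ultimately have "card (B - B') * n \<le> (16 * N\<^sup>2) * n" by linarith
  hence cB: "card (B - B') \<le> 16 * N\<^sup>2" using n by simp
  have "(\<Sum>w\<in>B' - {v}. x w) \<le> lam * x v"
  proof (rule relink_bound[OF v, where U = A and d = d])
    show "B' - {v} \<subseteq> V - {v}" using B' AB by auto
    show "card (A - nb w) \<le> d" if "w \<in> B' - {v}" for w using that by (auto simp: B'_def)
    have "2 * N * d \<le> card A" unfolding d_def by (rule times_div_less_eq_dividend)
    hence "2 * (N * d) \<le> card A" by (simp only: mult.assoc)
    moreover have "2 * N + 2 \<le> card A" using card_A_B_ge(1) n_ge(2) N_ge by linarith
    ultimately show "N * d + N + 1 \<le> card A" by linarith
  qed (rule AB)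
  moreover have "lam \<le> (\<Sum>w\<in>B' - {v}. x w) + 17 * real (N\<^sup>2)"
  proof -
    have "lam = (\<Sum>u\<in>B. x u)" using eig[OF vm(1)] vm(2) by (simp add: B_def)
    also have "\<dots> = (\<Sum>u\<in>B' - {v}. x u) + (\<Sum>u\<in>B - (B' - {v}). x u)"
      using B' AB by (intro sum.subset_diff[THEN trans[OF _ add.commute]]) auto
    also have "(\<Sum>u\<in>B - (B' - {v}). x u) \<le> real (card (B - (B' - {v})))"
      using AB by (intro sum_x_le_card) auto
    also have "card (B - (B' - {v})) \<le> card (insert v (B - B'))" using AB by (intro card_mono) auto
    also have "\<dots> \<le> card (B - B') + 1" using AB by (simp add: card_insert_if)
    also have "\<dots> \<le> 17 * N\<^sup>2" using cB N_le_N_sq N_ge by linarith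
    finally show ?thesis by simp
  qed
  ultimately show ?thesis by linarith
qed

text \<open>No entry of \<open>x\<close> exceeds 1, so the degree of \<open>v\<close> is at least
  \<open>lam * x v\<close>.\<close>

lemma degree_lower:
  assumes v: "v < n"
  shows "n \<le> 2 * card (nb v) + 36 * N\<^sup>2"
proof -
  have "lam * x v \<le> real (card (nb v))"
    using eig[OF v] sum_x_le_card[OF nb_subset, of v] by simp
  hence "lam - 17 * real (N\<^sup>2) \<le> real (card (nb v))" using x_lower[OF v] by (rule order_trans[rotated])
  moreover have "real n \<le> 2 * lam + 1" using lam_lower by simp
  ultimately have "real n \<le> 2 * (real (card (nb v)) + 17 * real (N\<^sup>2)) + 1" by argo
  also have "\<dots> = real (2 * card (nb v) + 34 * N\<^sup>2 + 1)" by simp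
  finally have "n \<le> 2 * card (nb v) + 34 * N\<^sup>2 + 1" unfolding of_nat_le_iff .
  thus ?thesis using N_le_N_sq N_ge by linarith
qed

text \<open>Nearly all pairs between \<open>A\<close> and \<open>B\<close> are adjacent, yet a
  neighbourhood is sparse, so \<open>card ?X * card ?Y\<close> is at most \<open>3 * N * n\<close>.
  One factor is at least \<open>n / 5\<close> by the degree bound, which leaves at most
  \<open>15 * N\<close> for the other.\<close>

lemma nb_one_sided:
  assumes v: "v < n"
  shows "card (nb v \<inter> A) \<le> 15 * N \<or> card (nb v \<inter> B) \<le> 15 * N"
proof (rule ccontr)
  let ?X = "nb v \<inter> A" and ?Y = "nb v \<inter> B"
  assume neg: "\<not> ?thesis"
  have fin: "finite ?X" "finite ?Y" by auto
  have un: "?X \<union> ?Y = nb v" using AB nb_subset by blast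
  have disj: "?X \<inter> ?Y = {}" using AB by auto
  have deg: "card ?X + card ?Y = card (nb v)" using card_Un_disjoint[OF fin disj] un by simp
  have "arcs (?X \<union> ?Y) (?X \<union> ?Y) = arcs ?X ?X + arcs ?X ?Y + (arcs ?Y ?X + arcs ?Y ?Y)"
    using fin disj by (simp only: arcs_Un_left arcs_Un_right)
  hence "2 * arcs ?X ?Y \<le> arcs (nb v) (nb v)" unfolding un using arcs_commute[of ?X ?Y] by linarith
  also have "\<dots> \<le> 2 * N * card (nb v)" using nb_arcs_le[OF ls3 no_embed, of v] v V by (simp add: N)
  also have "\<dots> \<le> 2 * N * n" using card_mono[OF finite_V nb_subset, of v] card_V by (intro mult_left_mono) auto
  finally have "arcs ?X ?Y \<le> N * n" by simp
  moreover have "miss ?X ?Y \<le> 2 * N * n"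
    using miss_mono[of A B ?X ?Y] miss_AB AB by simp
  ultimately have prod: "card ?X * card ?Y \<le> 3 * (N * n)" using miss_plus_arcs[OF fin] by linarith
  have "n \<le> 5 * card ?X \<or> n \<le> 5 * card ?Y"
    using degree_lower[OF v] deg n_ge(1) by linarith
  moreover have "n * (15 * N) < 5 * (card ?X * card ?Y)" if "n \<le> 5 * card ?X"
  proof -
    have "n * (15 * N) < n * card ?Y" using neg n by simp
    also have "\<dots> \<le> 5 * card ?X * card ?Y" using that by (intro mult_right_mono) auto
    finally show ?thesis by simp
  qed
  moreover have "n * (15 * N) < 5 * (card ?X * card ?Y)" if "n \<le> 5 * card ?Y"
  proof -
    have "n * (15 * N) < n * card ?X" using neg n by simp
    also have "\<dots> \<le> 5 * card ?Y * card ?X" using that by (intro mult_right_mono) auto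
    finally show ?thesis by simp
  qed
  ultimately have "n * (15 * N) < 5 * (card ?X * card ?Y)" by blast
  thus False using prod by (simp add: algebra_simps)
qed

section \<open>A bipartition with bounded defects at every vertex\<close>

definition near_bipartition :: "nat set \<Rightarrow> nat set \<Rightarrow> bool" where
  "near_bipartition S T \<longleftrightarrow> S \<union> T = V \<and> S \<inter> T = {} \<and>
     (\<forall>v\<in>S. card (nb v \<inter> S) \<le> D \<and> card (T - nb v) \<le> D) \<and>
     (\<forall>v\<in>T. card (nb v \<inter> T) \<le> D \<and> card (S - nb v) \<le> D) \<and>
     n \<le> 2 * card S + 2 * D \<and> n \<le> 2 * card T + 2 * D"

lemma near_bipartition_commute: "near_bipartition S T \<Longrightarrow> near_bipartition T S"
  unfolding near_bipartition_def by blast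

text \<open>Each vertex joins the side in which it has few neighbours; the sides obtained differ
  from \<open>A\<close> and \<open>B\<close> in only \<open>O(N)\<close> vertices.\<close>

lemma near_bipartition_exists: "\<exists>S T. near_bipartition S T"
proof -
  define S where "S = {v \<in> V. card (nb v \<inter> A) \<le> 15 * N}"
  define T where "T = V - S"
  have ST: "S \<union> T = V" "S \<inter> T = {}" "S \<subseteq> V" "T \<subseteq> V" by (auto simp: S_def T_def)
  have fin: "finite S" "finite T" using ST(3,4) by (auto intro: finite_subset)
  have S_A: "card (nb v \<inter> A) \<le> 15 * N" if "v \<in> S" for v using that by (simp add: S_def)
  have T_B: "card (nb v \<inter> B) \<le> 15 * N" if "v \<in> T" for v
    using that nb_one_sided[of v] V by (auto simp: T_def S_def)
  \<comment> \<open>A vertex of \<open>X\<close> with few neighbours in \<open>Y\<close> misses at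
    least \<open>n / 5\<close> of \<open>Y\<close>, and only \<open>2 * N * n\<close> pairs are
    missing in total.\<close>
  have few: "card Z \<le> 10 * N"
    if Z: "finite X" "finite Y" "miss X Y \<le> 2 * N * n" "n \<le> 4 * card Y" "Z \<subseteq> X" "\<And>v. v \<in> Z \<Longrightarrow> card (nb v \<inter> Y) \<le> 15 * N"
    for X Y Z
  proof -
    have "card Z * n \<le> 5 * miss Z Y"
    proof (rule card_mult_le_miss)
      fix u assume "u \<in> Z"
      hence "card (nb u \<inter> Y) \<le> 15 * N" by (rule Z(6))
      moreover have "card Y \<le> card (nb u \<inter> Y) + card (Y - nb u)"
        using card_Un_le[of "nb u \<inter> Y" "Y - nb u"] by (metis Int_Diff_Un Int_commute)
      ultimately show "n \<le> 5 * card (Y - nb u)" using Z(4) n_ge(2) by linarith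
    qed
    also have "miss Z Y \<le> miss X Y" using Z by (intro miss_mono) auto
    finally have "card Z * n \<le> (10 * N) * n" using Z(3) by linarith
    thus ?thesis using n by simp
  qed
  have AT: "card (A \<inter> T) \<le> 10 * N"
    by (rule few[OF AB(3,4) miss_AB card_A_B_ge(2)]) (use T_B in auto)
  have BS: "card (B \<inter> S) \<le> 10 * N"
    by (rule few[OF AB(4,3) _ card_A_B_ge(1)]) (use S_A miss_AB miss_commute[of A B] AB in auto)
  have inS: "card (nb v \<inter> S) \<le> 25 * N" if "v \<in> S" for v
  proof -
    have "nb v \<inter> S \<subseteq> (nb v \<inter> A) \<union> (B \<inter> S)" using AB nb_subset by blast
    hence "card (nb v \<inter> S) \<le> card ((nb v \<inter> A) \<union> (B \<inter> S))" using AB by (intro card_mono) auto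
    also have "\<dots> \<le> card (nb v \<inter> A) + card (B \<inter> S)" by (rule card_Un_le)
    finally show ?thesis using S_A[OF that] BS by linarith
  qed
  have inT: "card (nb v \<inter> T) \<le> 25 * N" if "v \<in> T" for v
  proof -
    have "nb v \<inter> T \<subseteq> (nb v \<inter> B) \<union> (A \<inter> T)" using AB nb_subset by blast
    hence "card (nb v \<inter> T) \<le> card ((nb v \<inter> B) \<union> (A \<inter> T))" using AB by (intro card_mono) auto
    also have "\<dots> \<le> card (nb v \<inter> B) + card (A \<inter> T)" by (rule card_Un_le)
    finally show ?thesis using T_B[OF that] AT by linarith
  qed
  have deg: "card (nb v) = card (nb v \<inter> S) + card (nb v \<inter> T)" for v
  proof -
    have "nb v = (nb v \<inter> S) \<union> (nb v \<inter> T)" using ST nb_subset[of v] by blast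
    thus ?thesis using card_Un_disjoint[of "nb v \<inter> S" "nb v \<inter> T"] ST(2) by fastforce
  qed
  have outS: "n \<le> 2 * card (nb v \<inter> T) + (36 * N\<^sup>2 + 50 * N)" if "v \<in> S" for v
    using degree_lower[of v] deg[of v] inS[OF that] that ST V by auto
  have outT: "n \<le> 2 * card (nb v \<inter> S) + (36 * N\<^sup>2 + 50 * N)" if "v \<in> T" for v
    using degree_lower[of v] deg[of v] inT[OF that] that ST V by auto
  have "A \<subseteq> (A \<inter> T) \<union> S" using AB(5) ST(1) by blast
  hence "card A \<le> card ((A \<inter> T) \<union> S)" using fin by (intro card_mono) auto
  hence "card A \<le> card (A \<inter> T) + card S" using card_Un_le order_trans by blast
  \<comment> \<open>One vertex on each side suffices: its degree bounds the size of the opposite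
    side from below.\<close>
  hence "0 < card S" using AT card_A_B_ge(1) n_ge(2) N_ge by linarith
  then obtain s where s: "s \<in> S" by (auto simp: card_gt_0_iff)
  have "B \<subseteq> (B \<inter> S) \<union> T" using AB(6) ST(1) by blast
  hence "card B \<le> card ((B \<inter> S) \<union> T)" using fin by (intro card_mono) auto
  hence "card B \<le> card (B \<inter> S) + card T" using card_Un_le order_trans by blast
  hence "0 < card T" using BS card_A_B_ge(2) n_ge(2) N_ge by linarith
  then obtain t where t: "t \<in> T" by (auto simp: card_gt_0_iff)
  have cT: "n \<le> 2 * card T + (36 * N\<^sup>2 + 50 * N)"
    using outS[OF s] card_mono[OF fin(2), of "nb s \<inter> T"] by auto
  have cS: "n \<le> 2 * card S + (36 * N\<^sup>2 + 50 * N)"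
    using outT[OF t] card_mono[OF fin(1), of "nb t \<inter> S"] by auto
  have cST: "card S + card T = n" using card_Un_disjoint[OF fin ST(2)] ST(1) card_V by simp
  have diff: "card (Y - nb v) + card (nb v \<inter> Y) = card Y" if "finite Y" for Y v
    using card_Diff_subset_Int[of Y "nb v"] card_mono[of Y "nb v \<inter> Y"] that by (simp add: Int_commute)
  \<comment> \<open>The error \<open>36 * N\<^sup>2 + 50 * N\<close> enters twice in the missing
    edges at a vertex, through its degree and through the size of the parts.\<close>
  have bound: "72 * N\<^sup>2 + 100 * N \<le> 2 * D" "25 * N \<le> D"
    using N_le_N_sq unfolding D by linarith+
  have "near_bipartition S T" unfolding near_bipartition_def
  proof (intro conjI ballI)
    fix v assume v: "v \<in> S"
    show "card (nb v \<inter> S) \<le> D" using inS[OF v] bound by linarith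
    show "card (T - nb v) \<le> D" using outS[OF v] cS cST diff[OF fin(2), of v] bound by linarith
  next
    fix v assume v: "v \<in> T"
    show "card (nb v \<inter> T) \<le> D" using inT[OF v] bound by linarith
    show "card (S - nb v) \<le> D" using outT[OF v] cT cST diff[OF fin(1), of v] bound by linarith
  qed (use ST cS cT bound in auto)
  thus ?thesis by blast
qed

end

text \<open>The second-order terms: all deviations of \<open>\<lambda>\<close>, of the part size and of the weight of a part
  from \<open>n/2\<close> are bounded, so \<open>\<lambda>\<^sup>2 - |S| |T|\<close> exceeds \<open>m\<close> by at most \<open>O(1/n)\<close>.\<close>

lemma excess_less:
  fixes n D Q l a X u w m z :: real
  assumes l: "\<bar>l - n / 2\<bar> \<le> 2 * D" and a: "\<bar>a - n / 2\<bar> \<le> D" and X: "\<bar>X - n / 2\<bar> \<le> 2 * D" "0 \<le> X"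
    and u: "\<bar>u\<bar> \<le> Q" and w: "\<bar>w\<bar> \<le> Q" and uw: "n * (u + w - m) \<le> 2 * D * Q"
    and m: "\<bar>m + 1\<bar> \<le> 5 * Q" and big: "28 * D * Q < n" and z: "z * X \<le> l * u + a * w"
  shows "z < m + 1"
proof (rule ccontr)
  assume "\<not> ?thesis"
  hence mX: "(m + 1) * X \<le> z * X" using X(2) by (intro mult_right_mono) auto
  have prod_le: "y * v \<le> A * B" if "\<bar>y\<bar> \<le> A" "\<bar>v\<bar> \<le> B" for y v A B :: real
  proof -
    have "y * v \<le> \<bar>y\<bar> * \<bar>v\<bar>" by (metis abs_ge_self abs_mult)
    also have "\<dots> \<le> A * B" using that by (intro mult_mono) auto
    finally show ?thesis .
  qed
  have "(l - n / 2) * u \<le> 2 * D * Q" "(a - n / 2) * w \<le> D * Q"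
    using prod_le[OF l u] prod_le[OF a w] by simp_all
  moreover have "(m + 1) * (n / 2 - X) \<le> 5 * Q * (2 * D)"
    using X(1) by (intro prod_le m) (simp add: abs_minus_commute)
  moreover have "l * u + a * w = n / 2 * (u + w) + (l - n / 2) * u + (a - n / 2) * w"
    by (simp add: algebra_simps)
  moreover have "(m + 1) * X = (m + 1) * (n / 2) - (m + 1) * (n / 2 - X)" by (simp add: algebra_simps)
  \<comment> \<open>The three errors are \<open>2\<close>, \<open>1\<close> and \<open>10\<close>
    times \<open>D * Q\<close>; \<open>uw\<close> adds one more, and doubling gives the
    \<open>28\<close> in \<open>big\<close>.\<close>
  ultimately have "(m + 1) * (n / 2) - n / 2 * (u + w) \<le> 13 * (D * Q)" using z mX by (simp add: field_simps)
  moreover have "(m + 1) * (n / 2) - n / 2 * (u + w) = n / 2 - n * (u + w - m) / 2"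
    by (simp add: field_simps)
  ultimately show False using uw big by (simp add: field_simps)
qed

section \<open>Bounded numbers of inner and missing edges, and the sharp upper bound on
  \<open>lam\<close>\<close>

context extremal
begin

lemma constants: "1376 * (D * D) \<le> n" "N * D \<le> D * D" "N \<le> D" "D \<le> D * D" "4 * N * 86 \<le> D"
proof -
  show "4 * N * 86 \<le> D" unfolding D using N_le_N_sq by linarith
  thus "N \<le> D" by linarith
  thus "N * D \<le> D * D" by (rule mult_right_mono) simp
  show "D \<le> D * D" by simp
  have "1 * (D * D) \<le> D * D\<^sup>2" using D_ge by (simp add: power2_eq_square)
  thus "1376 * (D * D) \<le> n" using n_ge(3) by linarith
qed

text \<open>\<open>x_lower\<close> divided by \<open>lam\<close>, which is at least
  \<open>n / 3\<close>; the constant fits because \<open>3 * 17 \<le> 86\<close>.\<close>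

lemma x_close_to_1:
  assumes "v < n"
  shows "real n * (1 - x v) \<le> real D"
proof -
  have "1000 \<le> n" using n_ge(2) N_ge by linarith
  hence "real n \<le> 3 * lam" using lam_lower by simp
  hence "real n * (1 - x v) \<le> 3 * lam * (1 - x v)" using x(2)[OF assms] by (intro mult_right_mono) auto
  also have "\<dots> = 3 * (lam - lam * x v)" by (simp add: algebra_simps)
  also have "\<dots> \<le> 3 * (17 * real (N\<^sup>2))" using x_lower[OF assms] by (intro mult_left_mono) (simp_all add: algebra_simps)
  also have "\<dots> \<le> real D" unfolding D by simp
  finally show ?thesis .
qed

text \<open>Positivity makes the gain from an added edge strict in
  \<open>nb_eq_other_side\<close>.\<close>

lemma x_pos: 
  assumes "v < n"
  shows "0 < x v"
proof (rule ccontr)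
  assume "\<not> ?thesis"
  hence "x v = 0" using x(1)[OF assms] by simp
  hence "n \<le> D" using x_close_to_1[OF assms] by simp
  thus False using constants D_ge by linarith
qed

lemma near_bipartitionD:
  assumes "near_bipartition S T"
  shows "S \<union> T = V" "S \<inter> T = {}" "finite S" "finite T" "S \<subseteq> V" "T \<subseteq> V"
    "\<And>v. v \<in> S \<Longrightarrow> card (nb v \<inter> S) \<le> D" "\<And>v. v \<in> S \<Longrightarrow> card (T - nb v) \<le> D"
    "\<And>v. v \<in> T \<Longrightarrow> card (S - nb v) \<le> D"
    "n \<le> 2 * card S + 2 * D" "n \<le> 2 * card T + 2 * D" "card S + card T = n"
proof -
  show ST: "S \<union> T = V" "S \<inter> T = {}" "S \<subseteq> V" "T \<subseteq> V"
    using assms unfolding near_bipartition_def by auto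
  show fin: "finite S" "finite T" using ST(3,4) by (auto intro: finite_subset)
  show "card S + card T = n" using card_Un_disjoint[OF fin ST(2)] ST(1) card_V by simp
qed (use assms in \<open>auto simp: near_bipartition_def\<close>)

lemma inner_arcs_bound:
  assumes "near_bipartition S T"
  shows "arcs S S \<le> 4 * N * D"
proof -
  note nb = near_bipartitionD[OF assms]
  let ?M = "length ls * sum_list ls"
  have M: "?M + 1 = N" by (simp add: N)
  have lD: "length ls * D \<le> N * D" using length_le by (rule mult_right_mono) simp
  have MD: "(?M + 1) * D = N * D" by (simp only: M)
  have "arcs S S \<le> 4 * length ls * D"
  proof (rule inner_arcs_le[OF ls nb(5,6,2,8,9,7) refl _ _ no_embed])
    have "2 * length ls * D = 2 * (length ls * D)" by simp
    thus "?M + 1 + 2 * length ls * D \<le> card T" using M lD constants nb(11) D_ge by linarith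
    show "?M + 2 * length ls + (?M + 1) * D \<le> card S"
      unfolding MD using M length_le constants nb(10) D_ge by linarith
  qed
  also have "4 * length ls * D = 4 * (length ls * D)" by simp
  also have "4 * (length ls * D) \<le> 4 * (N * D)" using lD by simp
  finally show ?thesis by simp
qed

text \<open>Reattaching \<open>v\<close> to all of \<open>T\<close> keeps the graph free, so an edge missing at \<open>v\<close> would
  contradict the maximality of \<open>\<lambda>\<close>.\<close>

lemma nb_eq_other_side:
  assumes "near_bipartition S T" "v \<in> S" "nb v \<inter> S = {}"
  shows "nb v = T"
proof (rule ccontr)
  note nb = near_bipartitionD[OF assms(1)]
  assume "nb v \<noteq> T"
  moreover have sub: "nb v \<subseteq> T" using assms(3) nb(1) nb_subset by blast
  ultimately obtain w where w: "w \<in> T - nb v" by blast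
  have v: "v < n" using assms(2) nb(5) V by auto
  have "(\<Sum>w\<in>T. x w) \<le> lam * x v"
  proof (rule relink_bound[OF v, where U = S and d = D])
    show "T \<subseteq> V - {v}" using nb(2,6) assms(2) by auto
    show "N * D + N + 1 \<le> card S" using constants nb(10) D_ge by linarith
  qed (use nb in auto)
  hence "(\<Sum>w\<in>T. x w) \<le> (\<Sum>w\<in>nb v. x w)" using eig[OF v] by simp
  moreover have "(\<Sum>w\<in>T. x w) = (\<Sum>w\<in>T - nb v. x w) + (\<Sum>w\<in>nb v. x w)"
    using sub nb(4) by (intro sum.subset_diff) auto
  moreover have "0 < (\<Sum>w\<in>T - nb v. x w)"
    using w nb(4,6) V x_pos by (intro sum_pos) auto
  ultimately show False by linarith
qed

text \<open>A vertex without inner neighbours misses nothing, and any other misses at most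
  \<open>D\<close>, hence at most \<open>D\<close> times its inner degree; summing reduces the claim
  to \<open>inner_arcs_bound\<close>.\<close>

lemma miss_bound:
  assumes "near_bipartition S T"
  shows "miss S T \<le> 4 * N * D * D"
proof -
  note nb = near_bipartitionD[OF assms]
  have "card (T - nb u) \<le> D * card (nb u \<inter> S)" if u: "u \<in> S" for u
  proof (cases "nb u \<inter> S = {}")
    case True
    thus ?thesis using nb_eq_other_side[OF assms u] by simp
  next
    case False
    hence "0 < card (nb u \<inter> S)" by (simp add: card_gt_0_iff)
    hence "D * 1 \<le> D * card (nb u \<inter> S)" by (intro mult_left_mono) auto
    thus ?thesis using nb(8)[OF u] by linarith
  qed
  hence "miss S T \<le> D * arcs S S"
    unfolding miss_def arcs_eq_sum[OF nb(3)] sum_distrib_left by (rule sum_mono)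
  also have "\<dots> \<le> D * (4 * N * D)" using inner_arcs_bound[OF assms] by (rule mult_left_mono) simp
  finally show ?thesis by (simp add: mult_ac)
qed

text \<open>The eigenvalue equation summed over \<open>S\<close>, with the order of summation
  exchanged. Inner neighbours count at most 1 each, and every missing cross edge costs at least
  \<open>1 - D / n\<close> by \<open>x_close_to_1\<close>.\<close>

lemma lam_weight_le:
  assumes "near_bipartition S T"
  shows "lam * (\<Sum>v\<in>S. x v) \<le>
    real (arcs S S) - (1 - real D / real n) * real (miss S T) + real (card S) * (\<Sum>v\<in>T. x v)"
proof -
  note nb = near_bipartitionD[OF assms]
  let ?c = "1 - real D / real n"
  have xge: "?c \<le> x u" if "u < n" for u
    using x_close_to_1[OF that] n by (simp add: field_simps)
  have nbV: "nb v = {u \<in> V. adj v u}" for v using adj_V by auto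
  have "lam * (\<Sum>v\<in>S. x v) = (\<Sum>v\<in>S. \<Sum>u\<in>nb v. x u)"
    unfolding sum_distrib_left using nb(5) V by (intro sum.cong refl eig[symmetric]) auto
  also have "\<dots> = (\<Sum>v\<in>S. \<Sum>u\<in>{u \<in> V. adj v u}. x u)" by (simp only: nbV)
  also have "\<dots> = (\<Sum>u\<in>V. \<Sum>v\<in>{v \<in> S. adj v u}. x u)"
    by (rule sum.swap_restrict[OF nb(3) finite_V])
  also have "\<dots> = (\<Sum>u\<in>V. real (card (nb u \<inter> S)) * x u)"
  proof (rule sum.cong[OF refl])
    fix u
    have "{v \<in> S. adj v u} = nb u \<inter> S" using adj_sym by auto
    thus "(\<Sum>v\<in>{v \<in> S. adj v u}. x u) = real (card (nb u \<inter> S)) * x u" by simp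
  qed
  also have "\<dots> = (\<Sum>u\<in>S. real (card (nb u \<inter> S)) * x u) + (\<Sum>u\<in>T. real (card (nb u \<inter> S)) * x u)"
    unfolding nb(1)[symmetric] by (rule sum.union_disjoint[OF nb(3,4,2)])
  also have "(\<Sum>u\<in>S. real (card (nb u \<inter> S)) * x u) \<le> (\<Sum>u\<in>S. real (card (nb u \<inter> S)))"
    using x(2) nb(5) V by (intro sum_mono mult_left_le) auto
  also have "(\<Sum>u\<in>S. real (card (nb u \<inter> S))) = real (arcs S S)"
    by (simp add: arcs_eq_sum[OF nb(3)])
  also have "(\<Sum>u\<in>T. real (card (nb u \<inter> S)) * x u) \<le> (\<Sum>u\<in>T. real (card S) * x u - ?c * real (card (S - nb u)))"
  proof (rule sum_mono)
    fix u assume u: "u \<in> T"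
    have "card (S - nb u) + card (nb u \<inter> S) = card S"
      using card_Diff_subset_Int[of S "nb u"] card_mono[of S "nb u \<inter> S"] nb(3) by (simp add: Int_commute)
    hence card_eq: "real (card (nb u \<inter> S)) = real (card S) - real (card (S - nb u))" by linarith
    have "?c * real (card (S - nb u)) \<le> real (card (S - nb u)) * x u"
      using mult_right_mono[OF xge[of u], of "real (card (S - nb u))"] u nb(6) V
      by (auto simp: mult.commute)
    thus "real (card (nb u \<inter> S)) * x u \<le> real (card S) * x u - ?c * real (card (S - nb u))"
      unfolding card_eq left_diff_distrib[of "real (card S)"] by (rule diff_left_mono)
  qed
  also have "\<dots> = real (card S) * (\<Sum>u\<in>T. x u) - ?c * real (miss T S)"
    by (simp add: sum_subtractf sum_distrib_left miss_def)
  finally show ?thesis using miss_commute[OF nb(3,4)] by simp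
qed

text \<open>\<open>lam_weight_le\<close> for both parts, with the weight of \<open>T\<close>
  eliminated, gives \<open>key\<close>. There \<open>lam\<close>, \<open>a\<close> and
  \<open>XS\<close> all lie within \<open>O(D)\<close> of \<open>n / 2\<close>, so
  \<open>excess_less\<close> can cancel them.\<close>

lemma lam_sq_less:
  assumes "near_bipartition S T"
  shows "lam\<^sup>2 < real (card S) * real (card T) + real (arcs S S) + real (arcs T T) - 2 * real (miss S T) + 1"
proof -
  note nb = near_bipartitionD[OF assms]
  note assms' = near_bipartition_commute[OF assms]
  define a b eS eT q XS XT where "a = real (card S)" and "b = real (card T)"
    and "eS = real (arcs S S)" and "eT = real (arcs T T)" and "q = real (miss S T)"
    and "XS = (\<Sum>v\<in>S. x v)" and "XT = (\<Sum>v\<in>T. x v)"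
  \<comment> \<open>\<open>Q\<close> bounds both the inner arcs, \<open>4 * N * D\<close>, and the
    missing edges, \<open>4 * N * D * D\<close>, because \<open>4 * N * 86 \<le> D\<close>.\<close>
  define d c Q where "d = real D" and "c = 1 - d / real n" and "Q = d ^ 3 / 86"
  have n0: "0 < real n" using n by simp
  have d: "1376 \<le> d" using D_ge by (simp add: d_def)
  have dd: "1376 * (d * d) \<le> real n"
  proof -
    have "real (1376 * (D * D)) \<le> real n" using constants(1) unfolding of_nat_le_iff .
    thus ?thesis by (simp add: d_def)
  qed
  have ddn: "d \<le> real n"
  proof -
    have "1 * d \<le> d * d" using d by (intro mult_right_mono) auto
    moreover have "0 \<le> d * d" by simp
    ultimately show ?thesis using dd by linarith
  qed
  have c: "0 \<le> c" "c \<le> 1" using ddn d n0 by (auto simp: c_def)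
  have d3: "d * d \<le> d ^ 3" "1376 * 1376 \<le> d * d"
  proof -
    have "1 * (d * d) \<le> d * (d * d)" using d by (intro mult_right_mono) auto
    thus "d * d \<le> d ^ 3" by (simp add: power3_eq_cube)
    show "1376 * 1376 \<le> d * d" using d by (intro mult_mono) auto
  qed
  have N4: "4 * real N \<le> d / 86"
  proof -
    have "real (4 * N * 86) \<le> real D" using constants(5) unfolding of_nat_le_iff .
    thus ?thesis by (simp add: d_def)
  qed
  have e_bound: "real (arcs X X) \<le> d * d / 86" if "near_bipartition X Y" for X Y
  proof -
    have "real (arcs X X) \<le> real (4 * N * D)"
      using inner_arcs_bound[OF that] unfolding of_nat_le_iff .
    also have "\<dots> = 4 * real N * d" by (simp add: d_def)
    also have "\<dots> \<le> d / 86 * d" using N4 d by (intro mult_right_mono) auto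
    finally show ?thesis by simp
  qed
  have eS: "0 \<le> eS" "eS \<le> Q" and eT: "0 \<le> eT" "eT \<le> Q"
    using e_bound[OF assms] e_bound[OF assms'] d3 by (auto simp: eS_def eT_def Q_def)
  have q: "0 \<le> q" "q \<le> Q"
  proof -
    have "q \<le> real (4 * N * D * D)" using miss_bound[OF assms] unfolding q_def of_nat_le_iff .
    also have "\<dots> = 4 * real N * (d * d)" by (simp add: d_def)
    also have "\<dots> \<le> d / 86 * (d * d)" using N4 by (intro mult_right_mono) auto
    finally show "q \<le> Q" by (simp add: Q_def power3_eq_cube)
  qed (simp add: q_def)
  have cq: "0 \<le> c * q" "c * q \<le> q" using c q mult_right_mono[of c 1 q] by auto
  have Q1: "1 \<le> Q" using d3 by (simp add: Q_def)
  have ab: "a + b = real n" "real n \<le> 2 * a + 2 * d" "real n \<le> 2 * b + 2 * d"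
  proof -
    show "a + b = real n" using nb(12) by (simp add: a_def b_def flip: of_nat_add)
    have "real n \<le> real (2 * card S + 2 * D)" "real n \<le> real (2 * card T + 2 * D)"
      using nb(10,11) unfolding of_nat_le_iff by auto
    thus "real n \<le> 2 * a + 2 * d" "real n \<le> 2 * b + 2 * d" by (simp_all add: a_def b_def d_def)
  qed
  have XS: "XS \<le> a" "a - d \<le> XS" "0 \<le> XS"
  proof -
    show "XS \<le> a" unfolding XS_def a_def using nb(5) by (rule sum_x_le_card)
    show "0 \<le> XS" unfolding XS_def using x(1) nb(5) V by (intro sum_nonneg) auto
    have "c \<le> x v" if "v \<in> S" for v
    proof -
      have "v < n" using that nb(5) V by auto
      thus ?thesis using x_close_to_1 n by (simp add: c_def d_def field_simps)
    qed
    hence "a * c \<le> XS" using sum_bounded_below[of S c x] by (simp add: XS_def a_def)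
    moreover have "a * c = a - d * (a / real n)" by (simp add: c_def field_simps)
    moreover have "d * (a / real n) \<le> d * 1"
      using d ab(1) n0 by (intro mult_left_mono) (auto simp: b_def)
    ultimately show "a - d \<le> XS" by linarith
  qed
  \<comment> \<open>At the heaviest vertex \<open>lam\<close> is at most the degree, that is, the
    opposite part plus \<open>D\<close> inner neighbours.\<close>
  have lam_le: "lam \<le> real n / 2 + 2 * d"
  proof -
    have deg: "real (card (nb vm)) \<le> d + real (card Y)" if "near_bipartition X Y" "vm \<in> X" for X Y
    proof -
      note XY = near_bipartitionD[OF that(1)]
      have "nb vm \<subseteq> (nb vm \<inter> X) \<union> Y" using XY(1) nb_subset by blast
      hence "card (nb vm) \<le> card ((nb vm \<inter> X) \<union> Y)" using XY by (intro card_mono) auto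
      also have "\<dots> \<le> card (nb vm \<inter> X) + card Y" by (rule card_Un_le)
      also have "\<dots> \<le> D + card Y" using XY(7)[OF that(2)] by simp
      finally show ?thesis unfolding d_def of_nat_add[symmetric] of_nat_le_iff .
    qed
    have "vm \<in> S \<or> vm \<in> T" using nb(1) vm(1) V by auto
    hence "real (card (nb vm)) \<le> d + a \<or> real (card (nb vm)) \<le> d + b"
      using deg[OF assms] deg[OF assms'] by (auto simp: a_def b_def)
    moreover have "lam \<le> real (card (nb vm))"
      using eig[OF vm(1)] vm(2) sum_x_le_card[OF nb_subset, of vm] by simp
    ultimately show ?thesis using ab by linarith
  qed
  have S_eq: "lam * XS \<le> eS - c * q + a * XT"
    using lam_weight_le[OF assms] by (simp add: XS_def XT_def eS_def q_def a_def c_def d_def)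
  have T_eq: "lam * XT \<le> eT - c * q + b * XS"
    using lam_weight_le[OF assms'] miss_commute[OF nb(3,4)]
    by (simp add: XS_def XT_def eT_def q_def b_def c_def d_def)
  have "lam * (lam * XS) \<le> lam * (eS - c * q) + a * (lam * XT)"
    using mult_left_mono[OF S_eq lam_nonneg] by (simp add: algebra_simps)
  also have "a * (lam * XT) \<le> a * (eT - c * q + b * XS)"
    using T_eq by (rule mult_left_mono) (simp add: a_def)
  finally have key: "(lam\<^sup>2 - a * b) * XS \<le> lam * (eS - c * q) + a * (eT - c * q)"
    by (simp add: algebra_simps power2_eq_square)
  have "lam\<^sup>2 - a * b < (eS + eT - 2 * q) + 1"
  proof (rule excess_less[OF _ _ _ XS(3) _ _ _ _ _ key])
    show "\<bar>lam - real n / 2\<bar> \<le> 2 * d" using lam_le lam_lower d by (simp add: abs_le_iff)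
    show "\<bar>a - real n / 2\<bar> \<le> d" using ab by (simp add: abs_le_iff)
    show "\<bar>XS - real n / 2\<bar> \<le> 2 * d" using ab XS d unfolding abs_le_iff by linarith
    show "\<bar>eS - c * q\<bar> \<le> Q" "\<bar>eT - c * q\<bar> \<le> Q" using eS eT q cq unfolding abs_le_iff by linarith+
    show "\<bar>eS + eT - 2 * q + 1\<bar> \<le> 5 * Q" using eS eT q Q1 unfolding abs_le_iff by linarith
    \<comment> \<open>Counting each missing edge with weight 1 instead of \<open>c\<close> changes
      the sum by only \<open>2 * d * q / n\<close>.\<close>
    have "real n * (eS - c * q + (eT - c * q) - (eS + eT - 2 * q)) = 2 * d * q"
      using n0 by (simp add: c_def field_simps)
    also have "\<dots> \<le> 2 * d * Q" using q d by (intro mult_left_mono) auto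
    finally show "real n * (eS - c * q + (eT - c * q) - (eS + eT - 2 * q)) \<le> 2 * d * Q" .
    have "d ^ 4 \<le> real n"
      using large unfolding d_def of_nat_power[symmetric] of_nat_le_iff .
    moreover have "28 * d * Q = 28 / 86 * d ^ 4" by (simp add: Q_def power4_eq_xxxx power3_eq_cube)
    moreover have "0 < d ^ 4" using d by simp
    ultimately show "28 * d * Q < real n" by linarith
  qed
  thus ?thesis by (simp add: a_def b_def eS_def eT_def q_def)
qed

section \<open>Comparing numbers of edges\<close>

lemma double_edges:
  assumes "near_bipartition S T"
  shows "2 * card (edges G) + 2 * miss S T = arcs S S + arcs T T + 2 * (card S * card T)"
proof -
  note nb = near_bipartitionD[OF assms]
  have "2 * card (edges G) = arcs (S \<union> T) (S \<union> T)" using arcs_VV nb(1) by simp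
  also have "\<dots> = arcs S S + arcs S T + (arcs T S + arcs T T)"
    using nb(2,3,4) by (simp only: arcs_Un_left arcs_Un_right)
  finally show ?thesis using arcs_commute[of S T] miss_plus_arcs[OF nb(3,4)] by linarith
qed

text \<open>Moving ordinary vertices from the larger to the smaller part balances the parts without
  changing the numbers of inner and of missing edges.\<close>

lemma balanced_competitor:
  assumes nbip: "near_bipartition S T" and le: "card T \<le> card S"
  shows "\<exists>G'. simple_graph G' \<and> vertices G' = {..<n} \<and> \<not> embeds (cycle_bouquet ls) G' \<and>
    2 * card (edges G') + 2 * miss S T = 2 * (n\<^sup>2 div 4) + arcs S S + arcs T T"
proof -
  note nb = near_bipartitionD[OF nbip]
  \<comment> \<open>These vertices are joined to exactly \<open>T\<close>. All others contribute to
    \<open>arcs S S\<close>, so there are few of them.\<close>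
  define S0 where "S0 = {v \<in> S. nb v \<inter> S = {}}"
  have S0: "S0 \<subseteq> S" "finite S0" using nb(3) by (auto simp: S0_def)
  have "card (S - S0) \<le> (\<Sum>u\<in>S - S0. card (nb u \<inter> S))"
  proof -
    have "1 \<le> card (nb u \<inter> S)" if "u \<in> S - S0" for u
      using that nb(3) by (auto simp: S0_def Suc_le_eq card_gt_0_iff)
    thus ?thesis using sum_bounded_below[of "S - S0" 1 "\<lambda>u. card (nb u \<inter> S)"] by simp
  qed
  also have "\<dots> \<le> arcs S S" unfolding arcs_eq_sum[OF nb(3)] using nb(3) by (intro sum_mono2) auto
  finally have "card (S - S0) \<le> 4 * N * D" using inner_arcs_bound[OF nbip] by linarith
  moreover have "card S - card S0 \<le> card (S - S0)" by (rule diff_card_le_card_Diff[OF S0(2)])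
  moreover have "4 * N * D = 4 * (N * D)" by simp
  ultimately have cS0: "D \<le> card S0" using constants nb(10) D_ge by linarith
  \<comment> \<open>Moving \<open>j\<close> vertices gives parts of sizes \<open>n div 2\<close> and
    \<open>n - n div 2\<close>; the size bounds on the parts give \<open>j \<le> D\<close>.\<close>
  define j where "j = (card S - card T) div 2"
  have "j \<le> card S0" using cS0 nb(11,12) unfolding j_def by linarith
  then obtain J where J: "J \<subseteq> S0" "card J = j" "finite J"
    by (rule obtain_subset_with_card_n)
  have JS: "J \<subseteq> S" using J S0 by auto
  have nbJ: "nb u = T" if "u \<in> J" for u
    using nb_eq_other_side[OF nbip, of u] that J(1) by (auto simp: S0_def)
  \<comment> \<open>\<open>J\<close> changes sides: its neighbourhood \<open>T\<close> is replaced
    by the rest of \<open>S\<close>. No inner edge and no missing cross pair involves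
    \<open>J\<close>, before or after.\<close>
  let ?G = "relink J (S - J)"
  have simple': "simple_graph ?G" using JS nb(5) by (intro simple_relink) auto
  moreover have "vertices ?G = {..<n}" using V by (simp add: relink_def)
  moreover have "\<not> embeds (cycle_bouquet ls) ?G"
  proof
    assume emb: "embeds (cycle_bouquet ls) ?G"
    have "embeds (cycle_bouquet ls) G"
    proof (rule embeds_relink[OF simple_graph_cycle_bouquet[OF ls3] _ _ emb])
      fix X assume X: "X \<subseteq> S - J" "finite X" "card X \<le> card (vertices (cycle_bouquet ls))"
      have "card T \<le> card {u \<in> T. \<forall>w\<in>X. adj u w} + card X * D"
        using X nb(4,8) by (intro card_common_nb) auto
      moreover have "card X * D \<le> N * D" using X(3) card_bouquet_le by (intro mult_right_mono) auto
      moreover have "card {u \<in> T. \<forall>w\<in>X. adj u w} \<le> card {u \<in> V - J. \<forall>w\<in>X. adj u w}"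
        using nb(2,6) JS by (intro card_mono) auto
      ultimately show "card (vertices (cycle_bouquet ls)) \<le> card {u \<in> V - J. \<forall>w\<in>X. adj u w}"
        using constants nb(11) D_ge card_bouquet_le by linarith
    qed auto
    thus False using no_embed by simp
  qed
  moreover have "2 * card (edges ?G) + 2 * miss S T = 2 * (n\<^sup>2 div 4) + arcs S S + arcs T T"
  proof -
    let ?E = "{e \<in> edges G. e \<inter> J = {}}"
    let ?K = "\<lambda>Y. {{u, w} | u w. u \<in> J \<and> w \<in> Y}"
    have finE: "finite ?E"
      by (rule finite_subset[of _ "Pow V"]) (use simple in \<open>auto simp: simple_graph_def\<close>)
    have finK: "finite (?K Y)" if "finite Y" for Y
      by (rule finite_subset[of _ "(\<lambda>(u, w). {u, w}) ` (J \<times> Y)"]) (use that J(3) in auto)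
    have disj: "?E \<inter> ?K Y = {}" for Y by blast
    have cK: "card (?K Y) = j * card Y" if "finite Y" "J \<inter> Y = {}" for Y
      using card_complete_bipartite_edges[OF J(3) that] J(2) by simp
    have "edges G = ?E \<union> ?K T"
    proof
      show "edges G \<subseteq> ?E \<union> ?K T"
      proof
        fix e assume e: "e \<in> edges G"
        show "e \<in> ?E \<union> ?K T"
        proof (cases "e \<inter> J = {}")
          case False
          then obtain u where u: "u \<in> e" "u \<in> J" by auto
          have "card e = 2" using e simple by (simp add: simple_graph_def)
          then obtain w where w: "e = {u, w}" using u(1) by (auto simp: card_2_iff)
          hence "w \<in> T" using e nbJ[OF u(2)] by (auto simp: adj_def nb_def)
          thus ?thesis using u w by blast
        qed (use e in auto)
      qed
      show "?E \<union> ?K T \<subseteq> edges G" using nbJ by (auto simp: nb_def adj_def)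
    qed
    hence "card (edges G) = card ?E + card (?K T)"
      using card_Un_disjoint[OF finE finK[OF nb(4)] disj] by simp
    also have "card (?K T) = j * card T" using nb(2,4) JS by (intro cK) auto
    finally have cG: "card (edges G) = card ?E + j * card T" .
    have "card (edges ?G) = card ?E + card (?K (S - J))"
      using card_Un_disjoint[OF finE finK[of "S - J"] disj] nb(3) by (simp add: relink_def)
    also have "card (?K (S - J)) = j * card (S - J)" using nb(3) by (intro cK) auto
    also have "card (S - J) = card S - j" using card_Diff_subset[OF J(3) JS] J(2) by simp
    finally have cG': "card (edges ?G) = card ?E + j * (card S - j)" .
    have half: "card T + j = n div 2" "card S - j = n - n div 2" "j \<le> card S"
      using nb(12) le unfolding j_def by linarith+
    have "(card T + j) * (card S - j) = n\<^sup>2 div 4" unfolding half by (rule half_mult_half)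
    moreover have "(card T + j) * (card S - j) + j * card T = card S * card T + j * (card S - j)"
    proof -
      obtain p where "card S = j + p" using half(3) le_iff_add by auto
      thus ?thesis by (simp add: algebra_simps)
    qed
    ultimately show ?thesis using cG cG' double_edges[OF nbip] by linarith
  qed
  ultimately show ?thesis by blast
qed

lemma edges_maximal:
  assumes H: "simple_graph H" "vertices H = {..<n}" "\<not> embeds (cycle_bouquet ls) H"
  shows "card (edges H) \<le> card (edges G)"
proof -
  obtain S T where nbip: "near_bipartition S T" and le: "card T \<le> card S"
    using near_bipartition_exists near_bipartition_commute by (metis nat_le_linear)
  note nb = near_bipartitionD[OF nbip]
  \<comment> \<open>The general lower bound on the spectral radius of \<open>H'\<close> against
    \<open>lam_sq_less\<close> for \<open>G\<close>; both sides are integers, so the strict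
    \<open>+ 1\<close> disappears.\<close>
  have upper: "2 * card (edges H') + 2 * miss S T \<le> n\<^sup>2 div 4 + card S * card T + arcs S S + arcs T T"
    if H': "simple_graph H'" "vertices H' = {..<n}" "\<not> embeds (cycle_bouquet ls) H'" for H'
  proof -
    interpret H': nat_graph H' n using H' n by unfold_locales auto
    have "H'.lam\<^sup>2 \<le> lam\<^sup>2" using lam_max[OF H'] H'.lam_nonneg by (intro power_mono) auto
    hence "real (2 * card (edges H') + 2 * miss S T) <
        real (n\<^sup>2 div 4 + card S * card T + arcs S S + arcs T T + 1)"
      using H'.lam_sq_ge lam_sq_less[OF nbip] by simp
    thus ?thesis unfolding of_nat_less_iff by simp
  qed
  obtain G' where G': "simple_graph G'" "vertices G' = {..<n}" "\<not> embeds (cycle_bouquet ls) G'"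
    "2 * card (edges G') + 2 * miss S T = 2 * (n\<^sup>2 div 4) + arcs S S + arcs T T"
    using balanced_competitor[OF nbip le] by blast
  \<comment> \<open>For the balanced competitor \<open>upper\<close> says that the parts of
    \<open>G\<close> were balanced already; for \<open>H\<close> it then bounds the edges by those
    of \<open>G\<close>.\<close>
  have "n\<^sup>2 div 4 \<le> card S * card T" using upper[OF G'(1-3)] G'(4) by linarith
  moreover have "card S * card T \<le> n\<^sup>2 div 4" using nb(12) by (rule mult_le_quarter_square)
  ultimately show ?thesis using upper[OF H] double_edges[OF nbip] by linarith
qed

end

section \<open>Passage from the locale to \<open>Ex_graphs\<close>, with threshold
  \<open>D ^ 4\<close>\<close>

theorem theorem1p5:
  fixes s k :: nat and ts :: "nat list"
  assumes "k \<ge> 1" and "length ts = k"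
    and "\<forall>t\<in>set ts. odd t \<and> t \<ge> 5"
  shows "\<exists>n0. \<forall>n\<ge>n0. \<forall>G.
    G \<in> spectral_extremal_graphs n (intersecting_odd_cycles s ts) \<longrightarrow>
    G \<in> Ex_graphs n (intersecting_odd_cycles s ts)"
proof -
  \<comment> \<open>The triangles enter the list as odd cycles of length 3, so all cycles are
    treated alike.\<close>
  define ls where "ls = replicate s 3 @ ts"
  define N where "N = length ls * sum_list ls + 1"
  define D where "D = 86 * N\<^sup>2"
  have ls: "\<forall>t\<in>set ls. odd t \<and> 3 \<le> t" using assms(3) by (fastforce simp: ls_def)
  have ls_ne: "ls \<noteq> []" using assms(1,2) by (auto simp: ls_def)
  let ?F = "cycle_bouquet ls"
  have F: "simple_graph ?F" using ls by (intro simple_graph_cycle_bouquet) auto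
  have free: "H \<in> free_graphs n ?F \<longleftrightarrow> simple_graph H \<and> vertices H = {..<n} \<and> \<not> embeds ?F H" for n and H :: "nat graph"
    unfolding free_graphs_def using graph_free_iff_not_embeds[OF F] by blast
  have "G \<in> Ex_graphs n ?F" if large: "D ^ 4 \<le> n" and G: "G \<in> spectral_extremal_graphs n ?F" for n G
  proof -
    have Gf: "G \<in> free_graphs n ?F" using G by (simp add: spectral_extremal_graphs_def)
    have "0 < D ^ 4" by (simp add: D_def N_def)
    hence n0: "0 < n" using large by linarith
    interpret nat_graph G n using Gf n0 free by unfold_locales auto
    obtain x vm where x: "\<And>i. i < n \<Longrightarrow> 0 \<le> x i \<and> x i \<le> 1" "vm < n" "x vm = (1::real)"
      "\<And>i. i < n \<Longrightarrow> (\<Sum>j\<in>nb i. x j) = lam * x i"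
      using eigenvector by blast
    interpret extremal G n ls N D x vm
    proof
      show "\<not> embeds ?F G" using Gf free by blast
      show "spectral_radius (adjacency_matrix n G') \<le> lam"
        if "simple_graph G'" "vertices G' = {..<n}" "\<not> embeds ?F G'" for G'
        using G that free by (simp add: spectral_extremal_graphs_def)
      show "D ^ 4 \<le> n" by (rule large)
    qed (use ls ls_ne N_def D_def x in auto)
    have le: "card (edges H) \<le> card (edges G)" if "H \<in> free_graphs n ?F" for H
      using that free edges_maximal by blast
    have "ex_number n ?F = card (edges G)" unfolding ex_number_def
    proof (rule Max_eqI)
      show "finite ((\<lambda>G. card (edges G)) ` free_graphs n ?F)"
        by (rule finite_subset[of _ "{..card (edges G)}"]) (use le in auto)
    qed (use le Gf in auto)
    thus ?thesis using Gf by (simp add: Ex_graphs_def)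
  qed
  thus ?thesis unfolding intersecting_odd_cycles_def ls_def[symmetric] by blast
qed

end
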